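(* Let $\mathcal{M}$ be a simple matroid, and let $k\ge 3$ be an integer. Then: (i) For any set $K$ with $k$ elements, the construction which sends a $k$-net on $\mathcal{M}$ with underlying partition $\mathcal{M}=\coprod_{\alpha\in K}\mathcal{M}_\alpha$ to the function $\tau\in K^{\mathcal{M}}$ given by $\tau_u=\alpha$ for $u\in\mathcal{M}_\alpha$ induces a bijection $$\lambda_K\colon \{k\text{-nets on }\mathcal{M}\}\xrightarrow{\ \simeq\ } Z'_K(\mathcal{M})\setminus B_K(\mathcal{M}).$$ (ii) If $k\not\equiv 2 \bmod 4$, there is a commutative ring $K$ of cardinality $k$ such that $Z'_K(\mathcal{M})\subseteq Z_K(\mathcal{M})$. If, in fact, $k=p^s$ for some prime $p$, then $K$ can be chosen to be the Galois field $\mathbb{F}_{p^s}$.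
   Context: A matroid is simple if all subsets of size at most two are independent; $L_2(\mathcal{M})$ is the set of rank-$2$ flats of $\mathcal{M}$, and $u\vee v$ is the flat spanned by $u,v$. Nets: a $k$-multinet on $\mathcal{M}$ ($k\ge 3$) is a partition of $\mathcal{M}$ into $k$ non-empty subsets (classes) $\mathcal{M}_\alpha$, together with positive integer multiplicities $m\colon\mathcal{M}\to\mathbb{N}$ and a subset $\mathcal{X}\subseteq L_2(\mathcal{M})$ (the base locus) with $|X|>2$ for all $X\in\mathcal{X}$, such that: (1) $\sum_{u\in\mathcal{M}_\alpha}m_u=d$ is independent of $\alpha$; (2) if $u,v$ are in different classes, then $u\vee v\in\mathcal{X}$; (3) for each $X\in\mathcal{X}$, $n_X:=\sum_{u\in\mathcal{M}_\alpha\cap X}m_u$ is independent of $\alpha$; (4) for each $\alpha$ and $u,v\in\mathcal{M}_\alpha$ there is a sequence $u=u_0,\dots,u_r=v$ with $u_{i-1}\vee u_i\notin\mathcal{X}$ for $1\le i\le r$. A $k$-net is a $k$-multinet with $n_X=1$ for all $X\in\mathcal{X}$ (then all $m_u=1$). The classes are labelled, here by the elements of the $k$-element set $K$; relabelling the classes by a non-trivial permutation gives a different net. For a finite set $K$ with $k\ge 3$ elements: $B_K(\mathcal{M})\subseteq K^{\mathcal{M}}$ is the set of constant functions, and $Z'_K(\mathcal{M})\subseteq K^{\mathcal{M}}$ is the set of functions $\tau\colon\mathcal{M}\to K$ such that for every $X\in L_2(\mathcal{M})$ the restriction $\tau|_X\colon X\to K$ is either constant or bijective. For a (finite) commutative ring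 $K$: let $A(\mathcal{M})=E/(\partial e_S : S\text{ a circuit of }\mathcal{M})$ be the Orlik–Solomon algebra, where $E$ is the exterior algebra over $\mathbb{Z}$ on degree-one generators $e_u$, $u\in\mathcal{M}$, $\partial$ is the graded derivation of degree $-1$ with $\partial e_u=1$, and $e_S=\prod_{u\in S}e_u$. Then $A^1(\mathcal{M})\otimes K=K^{\mathcal{M}}$; put $\sigma=\sum_u e_u$ and $Z_K(\mathcal{M})=\{\tau\in K^{\mathcal{M}}\mid \sigma\tau=0\text{ in }A^2(\mathcal{M})\otimes K\}$. *)

theory Defs
  imports
    "HOL-Algebra.QuotRing"
    "HOL-Computational_Algebra.Primes"
    "HOL-Library.Disjoint_Sets"
    "HOL-Library.FuncSet"
begin

section \<open>Algebras over the integers\<close>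

text \<open>The integral monoid ring: finitely supported integer functions on \<open>M\<close> with convolution.\<close>

definition monoid_ring :: "('m, 'x) monoid_scheme \<Rightarrow> ('m \<Rightarrow> int) ring" where
  "monoid_ring M =
    \<lparr>carrier = {f. finite {x. f x \<noteq> 0} \<and> {x. f x \<noteq> 0} \<subseteq> carrier M},
     monoid.mult = (\<lambda>f g w. \<Sum>x | f x \<noteq> 0. \<Sum>y | g y \<noteq> 0.
               if x \<otimes>\<^bsub>M\<^esub> y = w then f x * g y else 0),
     monoid.one = (\<lambda>w. if w = \<one>\<^bsub>M\<^esub> then 1 else 0),
     ring.zero = (\<lambda>w. 0),
     ring.add = (\<lambda>f g w. f w + g w)\<rparr>"

definition monom :: "'m \<Rightarrow> 'm \<Rightarrow> int" where
  "monom x = (\<lambda>w. if w = x then 1 else 0)"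

definition free_monoid :: "'a set \<Rightarrow> 'a list monoid" where
  "free_monoid V = \<lparr>carrier = lists V, monoid.mult = (@), monoid.one = []\<rparr>"

text \<open>The tensor algebra of the free abelian group on \<open>V\<close>; a word is a pure tensor of basis
  elements.\<close>

definition tensor_algebra :: "'a set \<Rightarrow> ('a list \<Rightarrow> int) ring" where
  "tensor_algebra V = monoid_ring (free_monoid V)"

definition tensor_degree_one :: "'a set \<Rightarrow> ('a list \<Rightarrow> int) set" where
  "tensor_degree_one V = {x \<in> carrier (tensor_algebra V). \<forall>w. x w \<noteq> 0 \<longrightarrow> length w = 1}"

definition exterior_ideal :: "'a set \<Rightarrow> ('a list \<Rightarrow> int) set" where
  "exterior_ideal V =
    Idl\<^bsub>tensor_algebra V\<^esub> {x \<otimes>\<^bsub>tensor_algebra V\<^esub> x | x. x \<in> tensor_degree_one V}"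

definition exterior_algebra :: "'a set \<Rightarrow> ('a list \<Rightarrow> int) set ring" where
  "exterior_algebra V = tensor_algebra V Quot exterior_ideal V"

definition exterior_gen :: "'a set \<Rightarrow> 'a \<Rightarrow> ('a list \<Rightarrow> int) set" where
  "exterior_gen V u = exterior_ideal V +>\<^bsub>tensor_algebra V\<^esub> monom [u]"

primrec exterior_prod :: "'a set \<Rightarrow> 'a list \<Rightarrow> ('a list \<Rightarrow> int) set" where
  "exterior_prod V [] = \<one>\<^bsub>exterior_algebra V\<^esub>"
| "exterior_prod V (u # s) = exterior_gen V u \<otimes>\<^bsub>exterior_algebra V\<^esub> exterior_prod V s"

text \<open>The value on the monomial of \<open>s\<close> of the graded derivation of degree \<open>-1\<close> that sends every
  generator to \<open>1\<close>: the two equations are the graded Leibniz rule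
  \<open>\<partial>(e\<^sub>u y) = \<partial>(e\<^sub>u) y - e\<^sub>u \<partial>y\<close> with \<open>\<partial>(e\<^sub>u) = 1\<close>, together with \<open>\<partial>(1) = 0\<close>.\<close>

primrec boundary_prod :: "'a set \<Rightarrow> 'a list \<Rightarrow> ('a list \<Rightarrow> int) set" where
  "boundary_prod V [] = \<zero>\<^bsub>exterior_algebra V\<^esub>"
| "boundary_prod V (u # s) = exterior_prod V s
     \<ominus>\<^bsub>exterior_algebra V\<^esub> (exterior_gen V u \<otimes>\<^bsub>exterior_algebra V\<^esub> boundary_prod V s)"

text \<open>The tensor product of two rings over the integers. The monoid ring of the multiplicative
  monoid of pairs is the free abelian group on all pairs with
  \<open>(a, x) (b, y) = (a b, x y)\<close>; the ideal imposes biadditivity. The set of relations is stable, up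
  to sign, under multiplication by pairs, so the ideal is the subgroup it generates.\<close>

definition tensor_ideal :: "('a, 'x) ring_scheme \<Rightarrow> ('k, 'y) ring_scheme \<Rightarrow> ('a \<times> 'k \<Rightarrow> int) set"
  where
  "tensor_ideal A K =
    (let F = monoid_ring (A \<times>\<times> K) in
     Idl\<^bsub>F\<^esub>
      ({monom (a \<oplus>\<^bsub>A\<^esub> b, x) \<ominus>\<^bsub>F\<^esub> (monom (a, x) \<oplus>\<^bsub>F\<^esub> monom (b, x)) | a b x.
          a \<in> carrier A \<and> b \<in> carrier A \<and> x \<in> carrier K} \<union>
       {monom (a, x \<oplus>\<^bsub>K\<^esub> y) \<ominus>\<^bsub>F\<^esub> (monom (a, x) \<oplus>\<^bsub>F\<^esub> monom (a, y)) | a x y.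
          a \<in> carrier A \<and> x \<in> carrier K \<and> y \<in> carrier K}))"

definition tensor_ring :: "('a, 'x) ring_scheme \<Rightarrow> ('k, 'y) ring_scheme \<Rightarrow> ('a \<times> 'k \<Rightarrow> int) set ring"
  where "tensor_ring A K = monoid_ring (A \<times>\<times> K) Quot tensor_ideal A K"

definition pure_tensor ::
  "('a, 'x) ring_scheme \<Rightarrow> ('k, 'y) ring_scheme \<Rightarrow> 'a \<Rightarrow> 'k \<Rightarrow> ('a \<times> 'k \<Rightarrow> int) set" where
  "pure_tensor A K a x = tensor_ideal A K +>\<^bsub>monoid_ring (A \<times>\<times> K)\<^esub> monom (a, x)"


section \<open>Matroids, nets and cocycles\<close>

locale matroid =
  fixes E :: "'a set" and indep :: "'a set \<Rightarrow> bool"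
  assumes finite_ground: "finite E"
    and indep_subset_ground: "indep X \<Longrightarrow> X \<subseteq> E"
    and indep_empty: "indep {}"
    and indep_subset: "indep X \<Longrightarrow> Y \<subseteq> X \<Longrightarrow> indep Y"
    and augment: "indep X \<Longrightarrow> indep Y \<Longrightarrow> card X < card Y \<Longrightarrow> \<exists>y \<in> Y - X. indep (insert y X)"
begin

definition circuit :: "'a set \<Rightarrow> bool" where
  "circuit C \<longleftrightarrow> C \<subseteq> E \<and> \<not> indep C \<and> (\<forall>D. D \<subset> C \<longrightarrow> indep D)"

definition rank :: "'a set \<Rightarrow> nat" where
  "rank X = Max {card B | B. B \<subseteq> X \<and> indep B}"

definition closure :: "'a set \<Rightarrow> 'a set" where
  "closure X = {x \<in> E. rank (insert x X) = rank X}"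

definition flat :: "'a set \<Rightarrow> bool" where
  "flat F \<longleftrightarrow> F \<subseteq> E \<and> closure F = F"

definition L2 :: "'a set set" where
  "L2 = {X. flat X \<and> rank X = 2}"

definition join :: "'a \<Rightarrow> 'a \<Rightarrow> 'a set" where
  "join u v = closure {u, v}"

text \<open>A multinet consists of its classes \<open>P \<alpha>\<close> labelled by \<open>\<alpha> \<in> K\<close>, its multiplicities \<open>m\<close> and
  its base locus \<open>B\<close>. Both \<open>P\<close> and \<open>m\<close> are extensional, so that distinct triples are distinct
  multinets.\<close>

definition multinets :: "'b set \<Rightarrow> (('b \<Rightarrow> 'a set) \<times> ('a \<Rightarrow> nat) \<times> 'a set set) set" where
  "multinets K = {(P, m, B).
     3 \<le> card K \<and>
     P \<in> K \<rightarrow>\<^sub>E {S. S \<subseteq> E \<and> S \<noteq> {}} \<and> disjoint_family_on P K \<and> (\<Union>\<alpha>\<in>K. P \<alpha>) = E \<and>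
     m \<in> E \<rightarrow>\<^sub>E {n. 0 < n} \<and>
     B \<subseteq> L2 \<and> (\<forall>X\<in>B. 2 < card X) \<and>
     (\<exists>d. \<forall>\<alpha>\<in>K. (\<Sum>u\<in>P \<alpha>. m u) = d) \<and>
     (\<forall>\<alpha>\<in>K. \<forall>\<beta>\<in>K. \<alpha> \<noteq> \<beta> \<longrightarrow> (\<forall>u\<in>P \<alpha>. \<forall>v\<in>P \<beta>. join u v \<in> B)) \<and>
     (\<forall>X\<in>B. \<exists>n. \<forall>\<alpha>\<in>K. (\<Sum>u\<in>P \<alpha> \<inter> X. m u) = n) \<and>
     (\<forall>\<alpha>\<in>K. \<forall>u\<in>P \<alpha>. \<forall>v\<in>P \<alpha>. \<exists>(r::nat) w. w 0 = u \<and> w r = v \<and> (\<forall>i\<le>r. w i \<in> E) \<and>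
        (\<forall>i\<in>{1..r}. join (w (i - 1)) (w i) \<notin> B))}"

definition nets :: "'b set \<Rightarrow> (('b \<Rightarrow> 'a set) \<times> ('a \<Rightarrow> nat) \<times> 'a set set) set" where
  "nets K = {(P, m, B) \<in> multinets K. \<forall>X\<in>B. \<forall>\<alpha>\<in>K. (\<Sum>u\<in>P \<alpha> \<inter> X. m u) = 1}"

definition net_function ::
  "'b set \<Rightarrow> ('b \<Rightarrow> 'a set) \<times> ('a \<Rightarrow> nat) \<times> 'a set set \<Rightarrow> 'a \<Rightarrow> 'b" where
  "net_function K N = (\<lambda>u\<in>E. THE \<alpha>. \<alpha> \<in> K \<and> u \<in> fst N \<alpha>)"

text \<open>The set of functions from the ground set to \<open>K\<close> is rendered as \<open>E \<rightarrow>\<^sub>E K\<close>.\<close>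

definition const_functions :: "'b set \<Rightarrow> ('a \<Rightarrow> 'b) set" where
  "const_functions K = {\<tau> \<in> E \<rightarrow>\<^sub>E K. \<exists>c\<in>K. \<forall>u\<in>E. \<tau> u = c}"

definition special_functions :: "'b set \<Rightarrow> ('a \<Rightarrow> 'b) set" where
  "special_functions K = {\<tau> \<in> E \<rightarrow>\<^sub>E K.
     \<forall>X\<in>L2. (\<exists>c\<in>K. \<forall>u\<in>X. \<tau> u = c) \<or> bij_betw \<tau> X K}"

text \<open>The monomial of a circuit is determined up to sign, depending on the chosen enumeration;
  all enumerations are admitted, which does not change the ideal.\<close>

definition os_ideal :: "('a list \<Rightarrow> int) set set" where
  "os_ideal = Idl\<^bsub>exterior_algebra E\<^esub> {boundary_prod E s | s. distinct s \<and> circuit (set s)}"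

definition os_algebra :: "('a list \<Rightarrow> int) set set ring" where
  "os_algebra = exterior_algebra E Quot os_ideal"

definition os_gen :: "'a \<Rightarrow> ('a list \<Rightarrow> int) set set" where
  "os_gen u = os_ideal +>\<^bsub>exterior_algebra E\<^esub> exterior_gen E u"

text \<open>A function with values in \<open>K\<close> as a degree-one element of the Orlik-Solomon algebra tensored
  with \<open>K\<close>; the element \<open>\<sigma>\<close> corresponds to the constant function \<open>1\<close>.\<close>

definition os_one_form ::
  "('b, 'x) ring_scheme \<Rightarrow> ('a \<Rightarrow> 'b) \<Rightarrow> (('a list \<Rightarrow> int) set set \<times> 'b \<Rightarrow> int) set" where
  "os_one_form K \<tau> =
    (\<Oplus>\<^bsub>tensor_ring os_algebra K\<^esub>u\<in>E. pure_tensor os_algebra K (os_gen u) (\<tau> u))"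

text \<open>The product is homogeneous of degree two and the degree-two component is a direct summand,
  so it may equally be tested for vanishing in the whole algebra.\<close>

definition cocycles :: "('b, 'x) ring_scheme \<Rightarrow> ('a \<Rightarrow> 'b) set" where
  "cocycles K = {\<tau> \<in> E \<rightarrow>\<^sub>E carrier K.
     os_one_form K (\<lambda>u. \<one>\<^bsub>K\<^esub>) \<otimes>\<^bsub>tensor_ring os_algebra K\<^esub> os_one_form K \<tau>
       = \<zero>\<^bsub>tensor_ring os_algebra K\<^esub>}"

end

locale simple_matroid = matroid +
  assumes simple: "X \<subseteq> E \<Longrightarrow> card X \<le> 2 \<Longrightarrow> indep X"

end

theory Submission
  imports
    "HOL-Algebra.Algebraic_Closure"
    "HOL-Algebra.Chinese_Remainder"
    "HOL-Number_Theory.Residues"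
    Defs
begin

text \<open>
  In a simple matroid two distinct points lie on exactly one rank-two flat. For part (i), the
  multiplicities of a net are all \<open>1\<close> and its base locus consists of the lines on which the labelling
  is bijective, so a net is determined by its labelling; conversely, for a non-constant special
  function any two classes are both in bijection with the lines of the base locus through a point of
  a third class.

  For part (ii), the off-diagonal terms of \<open>\<sigma>\<tau> = \<Sum>\<^sub>u \<Sum>\<^sub>v \<tau>\<^sub>v e\<^sub>u e\<^sub>v\<close> are grouped
  by lines. On a line \<open>X\<close> with a chosen point \<open>x\<close> the relations of the Orlik-Solomon algebra give
  \<open>e\<^sub>u e\<^sub>v = e\<^sub>x e\<^sub>v - e\<^sub>x e\<^sub>u\<close>, so the contribution of \<open>X\<close> vanishes as soon as
  \<open>|X| \<tau>\<^sub>v = \<Sum>\<^sub>u \<tau>\<^sub>u\<close> for all \<open>v\<close> in \<open>X\<close>. This holds if \<open>\<tau>\<close> is constant on \<open>X\<close>, and, if \<open>\<tau>\<close> is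
  bijective on \<open>X\<close>, it says that the elements of \<open>K\<close> sum to \<open>0\<close>. This is the case for \<open>\<int>/k\<close> with
  \<open>k\<close> odd, for \<open>\<int>/2 \<times> \<int>/m\<close> with \<open>k = 2m\<close> and \<open>m\<close> even, and for every finite field with more than two
  elements.
\<close>

text \<open>The syntax for the polynomial variable would capture the name \<open>X\<close>.\<close>

no_notation var (\<open>X\<index>\<close>)

section \<open>Lines and nets\<close>

context matroid
begin

lemma indep_finite: "indep B \<Longrightarrow> finite B"
  using indep_subset_ground finite_ground finite_subset by blast

lemma finite_indep_cards: "finite {card B | B. B \<subseteq> X \<and> indep B}"
proof -
  have "{card B | B. B \<subseteq> X \<and> indep B} \<subseteq> {..card E}"
    using indep_subset_ground finite_ground by (auto intro: card_mono)
  then show ?thesis by (rule finite_subset) simp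
qed

lemma card_le_rank: "indep B \<Longrightarrow> B \<subseteq> X \<Longrightarrow> card B \<le> rank X"
  unfolding rank_def by (rule Max_ge[OF finite_indep_cards]) auto

lemma obtain_basis:
  obtains B where "B \<subseteq> X" "indep B" "card B = rank X"
proof -
  have "rank X \<in> {card B | B. B \<subseteq> X \<and> indep B}"
    unfolding rank_def by (rule Max_in[OF finite_indep_cards]) (use indep_empty in auto)
  then show thesis using that by auto
qed

lemma rank_mono: "X \<subseteq> Y \<Longrightarrow> rank X \<le> rank Y"
  using card_le_rank[of _ Y] obtain_basis[of X] by (metis order_trans)

text \<open>Induction on the number of missing elements: as long as \<open>B\<close> is too small,
  augmenting it from a basis of \<open>Y\<close> keeps it inside \<open>Y\<close>; once
  \<open>B\<close> has rank-many elements it serves itself.\<close>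

lemma extend_to_basis:
  assumes "indep B" "B \<subseteq> Y"
  obtains C where "B \<subseteq> C" "C \<subseteq> Y" "indep C" "card C = rank Y"
proof -
  have "\<exists>C. B \<subseteq> C \<and> C \<subseteq> Y \<and> indep C \<and> card C = rank Y"
    using assms
  proof (induction "rank Y - card B" arbitrary: B rule: less_induct)
    case less
    show ?case
    proof (cases "card B < rank Y")
      case True
      obtain D where D: "D \<subseteq> Y" "indep D" "card D = rank Y" by (rule obtain_basis)
      with augment[of B D] less.prems True obtain y where y: "y \<in> D - B" "indep (insert y B)" by auto
      have "card (insert y B) = Suc (card B)"
        using y indep_finite less.prems by simp
      moreover have "insert y B \<subseteq> Y" using y D less.prems by auto
      ultimately have "\<exists>C. insert y B \<subseteq> C \<and> C \<subseteq> Y \<and> indep C \<and> card C = rank Y"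
        using y True by (intro less.hyps) auto
      then show ?thesis by blast
    next
      case False
      then show ?thesis using card_le_rank less.prems by (metis nat_less_le order_refl)
    qed
  qed
  then show thesis using that by blast
qed

text \<open>This is monotonicity of closure. Extend a basis \<open>B\<close> of \<open>X\<close> to
  a basis \<open>C\<close> of \<open>Y\<close>. If adding \<open>x\<close> raised the rank of
  \<open>Y\<close>, augmentation would give a new element outside \<open>Y\<close>, hence
  \<open>x\<close> itself, and then \<open>insert x B\<close> would be an independent set too large
  for \<open>insert x X\<close>.\<close>

lemma rank_insert_eq_mono:
  assumes "rank (insert x X) = rank X" "X \<subseteq> Y"
  shows "rank (insert x Y) = rank Y"
proof (rule antisym)
  obtain B where B: "B \<subseteq> X" "indep B" "card B = rank X" by (rule obtain_basis)
  obtain C where C: "B \<subseteq> C" "C \<subseteq> Y" "indep C" "card C = rank Y"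
    using extend_to_basis[of B Y] B assms(2) by auto
  show "rank (insert x Y) \<le> rank Y"
  proof (rule ccontr)
    assume less: "\<not> rank (insert x Y) \<le> rank Y"
    obtain D where D: "D \<subseteq> insert x Y" "indep D" "card D = rank (insert x Y)"
      by (rule obtain_basis)
    obtain y where y: "y \<in> D - C" "indep (insert y C)"
      using augment[of C D] C D less by auto
    have "card (insert y C) = Suc (rank Y)" using y C indep_finite by simp
    then have "y \<notin> Y" using card_le_rank[OF y(2), of Y] C by auto
    then have "y = x" using y D by auto
    then have "indep (insert x B)" using y C indep_subset by (metis insert_mono)
    moreover have "card (insert x B) = Suc (rank X)"
      using y \<open>y = x\<close> B C indep_finite by (metis DiffD2 card_insert_disjoint subsetD)
    ultimately show False
      using card_le_rank[of "insert x B" "insert x X"] B(1) assms(1) by auto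
  qed
qed (auto intro: rank_mono)

lemma subset_closure: "X \<subseteq> E \<Longrightarrow> X \<subseteq> closure X"
  by (auto simp: closure_def insert_absorb)

text \<open>If the closure had larger rank, a basis of \<open>X\<close> could be augmented by a
  single point \<open>y\<close> of the closure, against the fact that adding \<open>y\<close> to
  \<open>X\<close> leaves the rank unchanged.\<close>

lemma rank_closure:
  assumes "X \<subseteq> E" shows "rank (closure X) = rank X"
proof (rule antisym)
  obtain B where B: "B \<subseteq> X" "indep B" "card B = rank X" by (rule obtain_basis)
  show "rank (closure X) \<le> rank X"
  proof (rule ccontr)
    assume less: "\<not> rank (closure X) \<le> rank X"
    obtain D where D: "D \<subseteq> closure X" "indep D" "card D = rank (closure X)"
      by (rule obtain_basis)
    obtain y where y: "y \<in> D - B" "indep (insert y B)"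
      using augment[of B D] B D less by auto
    have "card (insert y B) = Suc (rank X)" using y B indep_finite by simp
    moreover have "rank (insert y X) = rank X" using y D by (auto simp: closure_def)
    ultimately show False
      using card_le_rank[OF y(2), of "insert y X"] B(1) by auto
  qed
qed (rule rank_mono[OF subset_closure[OF assms]])

text \<open>Idempotence of closure: since \<open>closure X\<close> has the rank of \<open>X\<close>,
  a point that does not raise the rank of \<open>closure X\<close> cannot raise that of the smaller
  set \<open>X\<close>.\<close>

lemma flat_closure:
  assumes "X \<subseteq> E" shows "flat (closure X)"
proof -
  have *: "rank (insert x X) = rank X"
    if "rank (insert x (closure X)) = rank (closure X)" for x
  proof (rule antisym)
    show "rank (insert x X) \<le> rank X"
      using rank_mono[OF insert_mono[OF subset_closure[OF assms]], of x] that rank_closure[OF assms] by simp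
  qed (rule rank_mono[OF subset_insertI])
  have "closure (closure X) \<subseteq> closure X"
  proof
    fix x assume "x \<in> closure (closure X)"
    then have "x \<in> E" "rank (insert x (closure X)) = rank (closure X)"
      unfolding closure_def[of "closure X"] by blast+
    with *[of x] show "x \<in> closure X" unfolding closure_def by blast
  qed
  moreover have "closure X \<subseteq> E" by (auto simp: closure_def)
  ultimately show ?thesis
    using subset_closure[of "closure X"] by (auto simp: flat_def)
qed

lemma L2_subset: "X \<in> L2 \<Longrightarrow> X \<subseteq> E"
  by (auto simp: L2_def flat_def)

lemma finite_L2: "finite L2"
  by (rule finite_subset[of _ "Pow E"]) (use L2_subset finite_ground in auto)

lemma finite_line: "X \<in> L2 \<Longrightarrow> finite X"
  using L2_subset finite_ground finite_subset by blast

lemma line_obtains_pair: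
  assumes "X \<in> L2"
  obtains u v where "u \<in> X" "v \<in> X" "u \<noteq> v"
proof -
  obtain B where "B \<subseteq> X" "card B = 2"
    using obtain_basis[of X] assms by (auto simp: L2_def)
  then show thesis using that by (auto simp: card_2_iff)
qed

end

section \<open>Lines of a simple matroid\<close>

context simple_matroid
begin

lemma indep_pair: "u \<in> E \<Longrightarrow> v \<in> E \<Longrightarrow> indep {u, v}"
  by (rule simple) (auto simp: card_insert_if)

lemma rank_pair:
  assumes "u \<in> E" "v \<in> E" "u \<noteq> v" shows "rank {u, v} = 2"
proof (rule antisym)
  show "2 \<le> rank {u, v}"
    using card_le_rank[OF indep_pair[OF assms(1,2)], of "{u, v}"] assms by simp
  show "rank {u, v} \<le> 2"
    by (rule obtain_basis[of "{u, v}"]) (metis assms(3) card_2_iff card_mono finite.emptyI finite.insertI)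
qed

lemma join_L2: "u \<in> E \<Longrightarrow> v \<in> E \<Longrightarrow> u \<noteq> v \<Longrightarrow> join u v \<in> L2"
  using flat_closure[of "{u, v}"] rank_closure[of "{u, v}"] rank_pair
  by (auto simp: L2_def join_def)

lemma in_join: "u \<in> E \<Longrightarrow> v \<in> E \<Longrightarrow> u \<in> join u v \<and> v \<in> join u v"
  using subset_closure[of "{u, v}"] by (auto simp: join_def)

text \<open>Two points determine their line. One inclusion is monotonicity of closure; for the
  other, the rank of \<open>{u, v}\<close> with a further point of \<open>X\<close> is squeezed
  between 2 and the rank of \<open>X\<close>.\<close>

lemma join_eq:
  assumes X: "X \<in> L2" and uv: "u \<in> X" "v \<in> X" "u \<noteq> v"
  shows "join u v = X"
proof -
  have XE: "X \<subseteq> E" and r: "rank X = 2" and cl: "closure X = X"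
    using X by (auto simp: L2_def flat_def)
  have uvX: "{u, v} \<subseteq> X" using uv by simp
  have r2: "rank {u, v} = 2" using rank_pair uv XE by blast
  have "x \<in> X" if "x \<in> join u v" for x
    using that rank_insert_eq_mono[OF _ uvX, of x] cl by (auto simp: join_def closure_def)
  moreover have "x \<in> join u v" if "x \<in> X" for x
    using that rank_mono[of "{u, v}" "insert x {u, v}"] rank_mono[of "insert x {u, v}" X] r r2 uvX XE
    by (auto simp: join_def closure_def)
  ultimately show ?thesis by blast
qed

text \<open>Three points are dependent because the line has rank 2, and every proper subset has at
  most two elements, so simplicity applies. This produces the circuits that matter in degree two of
  the Orlik-Solomon algebra.\<close>

lemma line_circuit:
  assumes X: "X \<in> L2" and "u \<in> X" "v \<in> X" "w \<in> X" "distinct [u, v, w]"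
  shows "circuit {u, v, w}"
  unfolding circuit_def
proof (intro conjI allI impI)
  have r: "rank X = 2" using X by (simp add: L2_def)
  show E: "{u, v, w} \<subseteq> E" using assms L2_subset by blast
  show "\<not> indep {u, v, w}"
    using card_le_rank[of "{u, v, w}" X] assms r by auto
  fix D assume D: "D \<subset> {u, v, w}"
  have "card {u, v, w} = 3" using assms by simp
  then have "card D \<le> 2" using psubset_card_mono[OF _ D] by simp
  then show "indep D" using D E by (intro simple) auto
qed

section \<open>From nets to special functions\<close>

context
  fixes K :: "'b set" and P m B
  assumes net: "(P, m, B) \<in> nets K"
begin

lemma net_card: "3 \<le> card K"
  and net_P: "P \<in> K \<rightarrow>\<^sub>E {S. S \<subseteq> E \<and> S \<noteq> {}}"
  and net_disjoint: "disjoint_family_on P K"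
  and net_cover: "(\<Union>\<alpha>\<in>K. P \<alpha>) = E"
  and net_mult: "m \<in> E \<rightarrow>\<^sub>E {n. 0 < n}"
  and net_base: "B \<subseteq> L2"
  and net_join: "\<And>\<alpha> \<beta> u v. \<alpha> \<in> K \<Longrightarrow> \<beta> \<in> K \<Longrightarrow> \<alpha> \<noteq> \<beta> \<Longrightarrow> u \<in> P \<alpha> \<Longrightarrow> v \<in> P \<beta> \<Longrightarrow> join u v \<in> B"
  and net_sum: "\<And>X \<alpha>. X \<in> B \<Longrightarrow> \<alpha> \<in> K \<Longrightarrow> (\<Sum>u\<in>P \<alpha> \<inter> X. m u) = 1"
  using net unfolding nets_def multinets_def by (auto simp del: One_nat_def)

lemma net_function_eq:
  assumes "\<alpha> \<in> K" "u \<in> P \<alpha>" shows "net_function K (P, m, B) u = \<alpha>"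
proof -
  have "u \<in> E" using assms net_cover by blast
  moreover have "(THE \<alpha>. \<alpha> \<in> K \<and> u \<in> P \<alpha>) = \<alpha>"
    using assms net_disjoint by (intro the_equality) (auto simp: disjoint_family_on_def)
  ultimately show ?thesis by (simp add: net_function_def)
qed

lemma net_function_in: "u \<in> E \<Longrightarrow> net_function K (P, m, B) u \<in> K \<and> u \<in> P (net_function K (P, m, B) u)"
  using net_cover net_function_eq by fastforce

lemma net_function_ext: "net_function K (P, m, B) \<in> E \<rightarrow>\<^sub>E K"
  using net_function_in by (auto simp: net_function_def)

lemma net_class_eq: "\<alpha> \<in> K \<Longrightarrow> P \<alpha> = {u \<in> E. net_function K (P, m, B) u = \<alpha>}"
  using net_function_eq net_function_in net_cover by auto

text \<open>There are at least three labels and no class is empty, so a point of another class is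
  always available for the joining axiom.\<close>

lemma net_other_class:
  assumes "u \<in> E"
  obtains v where "v \<in> E" "net_function K (P, m, B) v \<noteq> net_function K (P, m, B) u"
proof -
  have "K \<noteq> {net_function K (P, m, B) u}"
    using net_card card.insert[of "{}" "net_function K (P, m, B) u"] by fastforce
  then obtain \<beta> where \<beta>: "\<beta> \<in> K" "\<beta> \<noteq> net_function K (P, m, B) u"
    using net_function_in[OF assms] by auto
  then obtain v where "v \<in> P \<beta>" using PiE_mem[OF net_P, of \<beta>] by auto
  moreover from this have "v \<in> E" using net_cover \<beta> by blast
  ultimately show thesis using that[of v] \<beta> net_function_eq[of \<beta> v] by simp
qed

lemma net_join_base:
  assumes "u \<in> E" "v \<in> E" "net_function K (P, m, B) u \<noteq> net_function K (P, m, B) v"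
  shows "join u v \<in> B"
  using net_join[OF _ _ assms(3)] net_function_in assms(1,2) by blast

text \<open>Positive integers with sum 1 consist of a single term equal to 1; this gives both the
  size of the intersection and the multiplicity.\<close>

lemma net_base_inter:
  assumes X: "X \<in> B" and \<alpha>: "\<alpha> \<in> K"
  shows "card (P \<alpha> \<inter> X) = 1" and "\<And>u. u \<in> P \<alpha> \<inter> X \<Longrightarrow> m u = 1"
proof -
  have fin: "finite (P \<alpha> \<inter> X)" using finite_line X net_base by blast
  have pos: "0 < m u" if "u \<in> P \<alpha> \<inter> X" for u
    using that net_mult net_cover \<alpha> by (auto simp: PiE_iff)
  have s: "(\<Sum>u\<in>P \<alpha> \<inter> X. m u) = 1" by (rule net_sum[OF X \<alpha>])
  obtain u where u: "u \<in> P \<alpha> \<inter> X" using s by (metis sum.empty ex_in_conv zero_neq_one)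
  have "m u + (\<Sum>v\<in>P \<alpha> \<inter> X - {u}. m v) = 1"
    using s sum.remove[OF fin u, of m] by simp
  with pos[OF u] have mu: "m u = 1" and "(\<Sum>v\<in>P \<alpha> \<inter> X - {u}. m v) = 0" by linarith+
  then have "\<forall>v\<in>P \<alpha> \<inter> X - {u}. m v = 0" using fin by simp
  then have eq: "P \<alpha> \<inter> X = {u}" using pos u by (metis DiffI equalityI insertCI insert_subset less_irrefl singletonD subsetI empty_subsetI)
  show "card (P \<alpha> \<inter> X) = 1" "\<And>u. u \<in> P \<alpha> \<inter> X \<Longrightarrow> m u = 1" using eq mu by auto
qed

text \<open>Joining \<open>u\<close> to a point of another class gives a line of the base locus
  through \<open>u\<close>.\<close>

lemma net_mult_one:
  assumes "u \<in> E" shows "m u = 1"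
proof -
  obtain v where v: "v \<in> E" "net_function K (P, m, B) v \<noteq> net_function K (P, m, B) u"
    using net_other_class[OF assms] .
  then have "join u v \<in> B" using net_join_base assms by metis
  then show ?thesis
    using net_base_inter(2)[of "join u v"] net_function_in[OF assms] in_join[OF assms v(1)] by blast
qed

text \<open>Recovers the base locus from the labelling. A base line meets each class exactly once;
  conversely, a bijective line has two points with different labels, and their join, which is the
  line, belongs to the base locus.\<close>

lemma net_base_iff: "X \<in> B \<longleftrightarrow> X \<in> L2 \<and> bij_betw (net_function K (P, m, B)) X K"
  (is "_ \<longleftrightarrow> _ \<and> bij_betw ?t X K")
proof
  assume X: "X \<in> B"
  then have XL: "X \<in> L2" using net_base by blast
  have one: "\<exists>!u. u \<in> X \<and> ?t u = \<alpha>" if "\<alpha> \<in> K" for \<alpha>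
  proof -
    have "card (P \<alpha> \<inter> X) = 1" by (rule net_base_inter(1)[OF X that])
    then obtain u where u: "P \<alpha> \<inter> X = {u}" by (auto simp: card_1_singleton_iff)
    show ?thesis
    proof (rule ex1I[of _ u])
      show "u \<in> X \<and> ?t u = \<alpha>" using u net_class_eq[OF that] by blast
      show "v = u" if "v \<in> X \<and> ?t v = \<alpha>" for v
        using that u net_class_eq[OF \<open>\<alpha> \<in> K\<close>] L2_subset[OF XL] by blast
    qed
  qed
  have "bij_betw ?t X K"
  proof (rule bij_betw_imageI)
    show "inj_on ?t X"
      using one net_function_in L2_subset[OF XL] unfolding inj_on_def by blast
    show "?t ` X = K"
      using one net_function_in L2_subset[OF XL] by blast
  qed
  with XL show "X \<in> L2 \<and> bij_betw ?t X K" by simp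
next
  assume X: "X \<in> L2 \<and> bij_betw ?t X K"
  obtain u v where uv: "u \<in> X" "v \<in> X" "u \<noteq> v" using line_obtains_pair X by blast
  then have "?t u \<noteq> ?t v" using X by (meson bij_betw_imp_inj_on inj_onD)
  then show "X \<in> B" using net_join_base join_eq[OF _ uv] X uv L2_subset by (metis subsetD)
qed

text \<open>On a line outside the base locus two different labels are impossible, since the join of
  their points would be that same line and lie in the base locus.\<close>

lemma net_function_special: "net_function K (P, m, B) \<in> special_functions K - const_functions K"
  (is "?t \<in> _")
proof -
  have "(\<exists>c\<in>K. \<forall>u\<in>X. ?t u = c) \<or> bij_betw ?t X K" if X: "X \<in> L2" for X
  proof (cases "X \<in> B")
    case True then show ?thesis using net_base_iff by blast
  next
    case False
    obtain u v where "u \<in> X" "v \<in> X" "u \<noteq> v" using line_obtains_pair X by blast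
    have "?t w = ?t u" if "w \<in> X" for w
      using net_join_base[of w u] join_eq[OF X that \<open>u \<in> X\<close>] False L2_subset[OF X] that \<open>u \<in> X\<close> by auto
    then show ?thesis using net_function_in L2_subset[OF X] \<open>u \<in> X\<close> by blast
  qed
  moreover have "?t \<notin> const_functions K"
  proof
    assume "?t \<in> const_functions K"
    then obtain c where "\<forall>u\<in>E. ?t u = c" by (auto simp: const_functions_def)
    moreover obtain \<alpha> where "\<alpha> \<in> K" using net_card by fastforce
    moreover obtain u where "u \<in> P \<alpha>" using net_P calculation by blast
    then have "u \<in> E" using net_cover \<open>\<alpha> \<in> K\<close> by blast
    ultimately show False using net_other_class by metis
  qed
  ultimately show ?thesis using net_function_ext by (auto simp: special_functions_def)
qed

end

text \<open>All three components are determined: the classes are the fibres, the multiplicities are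
  1, and the base locus consists of the bijective lines. Extensionality of \<open>P\<close> and
  \<open>m\<close> reduces equality to \<open>K\<close> and \<open>E\<close>.\<close>

lemma net_function_inj: "inj_on (net_function K) (nets K)"
proof (rule inj_onI)
  fix N N' assume N: "N \<in> nets K" "N' \<in> nets K" and eq: "net_function K N = net_function K N'"
  obtain P m B P' m' B' where [simp]: "N = (P, m, B)" "N' = (P', m', B')" by (metis prod_cases3)
  note n = N[simplified] and eq' = eq[simplified]
  have "P = P'"
    using net_class_eq[OF n(1)] net_class_eq[OF n(2)] eq'
    by (intro PiE_ext[OF net_P[OF n(1)] net_P[OF n(2)]]) simp
  moreover have "m = m'"
    using net_mult_one[OF n(1)] net_mult_one[OF n(2)]
    by (intro PiE_ext[OF net_mult[OF n(1)] net_mult[OF n(2)]]) simp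
  moreover have "B = B'"
    using net_base_iff[OF n(1)] net_base_iff[OF n(2)] eq' by auto
  ultimately show "N = N'" by simp
qed

section \<open>From special functions to nets\<close>

definition function_net :: "'b set \<Rightarrow> ('a \<Rightarrow> 'b) \<Rightarrow> ('b \<Rightarrow> 'a set) \<times> ('a \<Rightarrow> nat) \<times> 'a set set" where
  "function_net K \<tau> =
    (\<lambda>\<alpha>\<in>K. {u \<in> E. \<tau> u = \<alpha>}, \<lambda>u\<in>E. 1, {X \<in> L2. bij_betw \<tau> X K})"

context
  fixes K :: "'b set" and \<tau>
  assumes card3: "3 \<le> card K" and special: "\<tau> \<in> special_functions K"
    and nonconst: "\<tau> \<notin> const_functions K"
begin

lemma special_ext: "\<tau> \<in> E \<rightarrow>\<^sub>E K"
  using special by (simp add: special_functions_def)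

lemma special_in: "u \<in> E \<Longrightarrow> \<tau> u \<in> K"
  using special_ext by blast

lemma special_join_bij:
  assumes "u \<in> E" "v \<in> E" "\<tau> u \<noteq> \<tau> v"
  shows "join u v \<in> L2 \<and> bij_betw \<tau> (join u v) K"
proof -
  have L: "join u v \<in> L2" using join_L2 assms by blast
  then have "(\<exists>c\<in>K. \<forall>u\<in>join u v. \<tau> u = c) \<or> bij_betw \<tau> (join u v) K"
    using special by (simp add: special_functions_def)
  with L show ?thesis using in_join assms by metis
qed

text \<open>Non-constancy gives two points with different labels, and their join is a bijective
  line, which already carries every label.\<close>

lemma special_class_nonempty:
  assumes "\<alpha> \<in> K" shows "\<exists>u\<in>E. \<tau> u = \<alpha>"
proof -
  \<comment> \<open>Supplies the constant value in the case of an empty ground set.\<close>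
  obtain \<beta> where \<beta>: "\<beta> \<in> K" using card3 by fastforce
  have "\<exists>u\<in>E. \<exists>v\<in>E. \<tau> u \<noteq> \<tau> v"
  proof (rule ccontr)
    assume *: "\<not> ?thesis"
    then have "\<exists>c\<in>K. \<forall>u\<in>E. \<tau> u = c"
      using \<beta> special_in by (cases "E = {}") blast+
    then show False using nonconst special_ext by (auto simp: const_functions_def)
  qed
  then obtain u v where "u \<in> E" "v \<in> E" "\<tau> u \<noteq> \<tau> v" by blast
  then have b: "join u v \<in> L2" "bij_betw \<tau> (join u v) K" using special_join_bij by auto
  then obtain w where "w \<in> join u v" "\<tau> w = \<alpha>" using assms by (metis bij_betw_imp_surj_on imageE)
  then show ?thesis using b L2_subset by blast
qed

text \<open>Each point of a class lies on exactly one of the bijective lines through a fixed point \<open>w\<close>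
  outside the class, and each such line has exactly one point of the class.\<close>

lemma special_class_card:
  assumes w: "w \<in> E" and \<alpha>: "\<alpha> \<in> K" "\<tau> w \<noteq> \<alpha>"
  shows "card {u \<in> E. \<tau> u = \<alpha>} = card {X \<in> L2. w \<in> X \<and> bij_betw \<tau> X K}"
proof (rule bij_betw_same_card[of "\<lambda>u. join u w"], rule bij_betw_imageI)
  let ?A = "{u \<in> E. \<tau> u = \<alpha>}" and ?L = "{X \<in> L2. w \<in> X \<and> bij_betw \<tau> X K}"
  have in_L: "join u w \<in> ?L" if "u \<in> ?A" for u
    using that special_join_bij[of u w] in_join[of u w] w \<alpha> by auto
  show "inj_on (\<lambda>u. join u w) ?A"
  proof (rule inj_onI)
    fix u v assume uv: "u \<in> ?A" "v \<in> ?A" "join u w = join v w"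
    have "u \<in> join u w" "v \<in> join u w" "inj_on \<tau> (join u w)"
      using uv in_join[of u w] in_join[of v w] w in_L[OF uv(1)] by (auto simp: bij_betw_def)
    then show "u = v" using uv by (auto dest: inj_onD)
  qed
  show "(\<lambda>u. join u w) ` ?A = ?L"
  proof
    show "(\<lambda>u. join u w) ` ?A \<subseteq> ?L" using in_L by blast
    show "?L \<subseteq> (\<lambda>u. join u w) ` ?A"
    proof
      fix X assume X: "X \<in> ?L"
      then obtain u where u: "u \<in> X" "\<tau> u = \<alpha>" using \<alpha> by (auto simp: bij_betw_def)
      then have "join u w = X" using X \<alpha> join_eq by blast
      then show "X \<in> (\<lambda>u. join u w) ` ?A" using u X L2_subset by blast
    qed
  qed
qed

text \<open>Since there are at least three labels, a point \<open>w\<close> outside both classes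
  exists, and both have as many elements as there are bijective lines through
  \<open>w\<close>.\<close>

lemma special_class_card_eq:
  assumes "\<alpha> \<in> K" "\<beta> \<in> K"
  shows "card {u \<in> E. \<tau> u = \<alpha>} = card {u \<in> E. \<tau> u = \<beta>}"
proof -
  have "card {\<alpha>, \<beta>} < card K" using card3 by (auto simp: card_insert_if)
  then have "\<not> K \<subseteq> {\<alpha>, \<beta>}" by (meson card_mono finite.emptyI finite.insertI linorder_not_less)
  then obtain \<gamma> where \<gamma>: "\<gamma> \<in> K" "\<gamma> \<noteq> \<alpha>" "\<gamma> \<noteq> \<beta>" by blast
  then obtain w where "w \<in> E" "\<tau> w = \<gamma>" using special_class_nonempty by blast
  with special_class_card[of w \<alpha>] special_class_card[of w \<beta>] \<gamma> assms show ?thesis by simp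
qed

text \<open>Each bijective line meets each fibre in one point, which gives the local sums; the
  global sums are the equal fibre sizes. The restrictions to \<open>K\<close> and \<open>E\<close>
  in \<open>function_net\<close> provide the required extensionality.\<close>

lemma function_net_in: "function_net K \<tau> \<in> nets K"
proof -
  let ?P = "\<lambda>\<alpha>\<in>K. {u \<in> E. \<tau> u = \<alpha>}" and ?m = "\<lambda>u\<in>E. 1 :: nat"
    and ?B = "{X \<in> L2. bij_betw \<tau> X K}"
  have one: "(\<Sum>u\<in>?P \<alpha> \<inter> X. ?m u) = 1" if X: "X \<in> ?B" and \<alpha>: "\<alpha> \<in> K" for X \<alpha>
  proof -
    have "\<alpha> \<in> \<tau> ` X" using X \<alpha> by (auto simp: bij_betw_def)
    then obtain u where u: "u \<in> X" "\<tau> u = \<alpha>" by blast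
    then have "?P \<alpha> \<inter> X = {u}" using X \<alpha> L2_subset by (auto simp: bij_betw_def dest: inj_onD)
    moreover have "u \<in> E" using u X L2_subset by blast
    ultimately show ?thesis by simp
  qed
  have size: "(\<Sum>u\<in>?P \<alpha>. ?m u) = card {u \<in> E. \<tau> u = \<alpha>}" if "\<alpha> \<in> K" for \<alpha>
  proof -
    have "(\<Sum>u\<in>?P \<alpha>. ?m u) = (\<Sum>u\<in>?P \<alpha>. 1)" using that by (intro sum.cong) auto
    also have "\<dots> = card {u \<in> E. \<tau> u = \<alpha>}" using that by simp
    finally show ?thesis .
  qed
  obtain \<gamma> where \<gamma>: "\<gamma> \<in> K" using card3 by fastforce
  have "(?P, ?m, ?B) \<in> multinets K"
    unfolding multinets_def
  proof (intro CollectI case_prodI conjI)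
    show "3 \<le> card K" by (rule card3)
    show "?P \<in> K \<rightarrow>\<^sub>E {S. S \<subseteq> E \<and> S \<noteq> {}}"
      using special_class_nonempty by fastforce
    show "disjoint_family_on ?P K" by (auto simp: disjoint_family_on_def)
    show "(\<Union>\<alpha>\<in>K. ?P \<alpha>) = E" using special_in by auto
    show "?m \<in> E \<rightarrow>\<^sub>E {n. 0 < n}" by auto
    show "?B \<subseteq> L2" by auto
    show "\<forall>X\<in>?B. 2 < card X"
    proof
      fix X assume "X \<in> ?B"
      then have "card X = card K" using bij_betw_same_card by blast
      then show "2 < card X" using card3 by simp
    qed
    show "\<exists>d. \<forall>\<alpha>\<in>K. (\<Sum>u\<in>?P \<alpha>. ?m u) = d"
      using size special_class_card_eq[OF _ \<gamma>] by (intro exI[of _ "card {u \<in> E. \<tau> u = \<gamma>}"]) simp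
    show "\<forall>\<alpha>\<in>K. \<forall>\<beta>\<in>K. \<alpha> \<noteq> \<beta> \<longrightarrow> (\<forall>u\<in>?P \<alpha>. \<forall>v\<in>?P \<beta>. join u v \<in> ?B)"
      using special_join_bij by auto
    show "\<forall>X\<in>?B. \<exists>n. \<forall>\<alpha>\<in>K. (\<Sum>u\<in>?P \<alpha> \<inter> X. ?m u) = n"
      using one by blast
    show "\<forall>\<alpha>\<in>K. \<forall>u\<in>?P \<alpha>. \<forall>v\<in>?P \<alpha>. \<exists>(r::nat) w. w 0 = u \<and> w r = v \<and> (\<forall>i\<le>r. w i \<in> E) \<and>
        (\<forall>i\<in>{1..r}. join (w (i - 1)) (w i) \<notin> ?B)"
    proof (intro ballI)
      fix \<alpha> u v assume *: "\<alpha> \<in> K" "u \<in> ?P \<alpha>" "v \<in> ?P \<alpha>"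
      then have uv: "u \<in> E" "v \<in> E" "\<tau> u = \<tau> v" by auto
      show "\<exists>(r::nat) w. w 0 = u \<and> w r = v \<and> (\<forall>i\<le>r. w i \<in> E) \<and>
        (\<forall>i\<in>{1..r}. join (w (i - 1)) (w i) \<notin> ?B)"
      \<comment> \<open>A chain of length 0 or 1 suffices: two distinct points with the same label
        cannot both lie on a bijective line.\<close>
      proof (cases "u = v")
        case True
        then show ?thesis using uv by (intro exI[of _ 0] exI[of _ "\<lambda>_. u"]) auto
      next
        case False
        have "\<not> bij_betw \<tau> (join u v) K"
          using in_join[OF uv(1,2)] uv(3) False by (auto simp: bij_betw_def dest: inj_onD)
        then show ?thesis using uv
          by (intro exI[of _ 1] exI[of _ "\<lambda>i. if i = 0 then u else v"]) auto
      qed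
    qed
  qed
  then show ?thesis using one by (auto simp: nets_def function_net_def)
qed

lemma net_function_function_net: "net_function K (function_net K \<tau>) = \<tau>"
proof -
  obtain P m B where N: "function_net K \<tau> = (P, m, B)" by (metis prod_cases3)
  then have net: "(P, m, B) \<in> nets K" using function_net_in by simp
  have "net_function K (P, m, B) u = \<tau> u" if "u \<in> E" for u
    using N special_in[OF that] that by (intro net_function_eq[OF net]) (auto simp: function_net_def)
  then show ?thesis
    unfolding N by (intro PiE_ext[OF net_function_ext[OF net] special_ext]) simp
qed

end

theorem net_function_bij_betw:
  assumes "3 \<le> card K"
  shows "bij_betw (net_function K) (nets K) (special_functions K - const_functions K)"
proof (rule bij_betw_imageI[OF net_function_inj])
  have "net_function K N \<in> special_functions K - const_functions K" if "N \<in> nets K" for N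
    using net_function_special[of "fst N" "fst (snd N)" "snd (snd N)" K] that by simp
  moreover have "\<tau> \<in> net_function K ` nets K" if "\<tau> \<in> special_functions K - const_functions K" for \<tau>
    using function_net_in[OF assms, of \<tau>] net_function_function_net[OF assms, of \<tau>] that
    by (metis Diff_iff image_eqI)
  ultimately show "net_function K ` nets K = special_functions K - const_functions K" by blast
qed

end

section \<open>Finite sums\<close>

lemma (in abelian_monoid) finsum_swap:
  assumes "finite I" "finite J" "\<And>i j. i \<in> I \<Longrightarrow> j \<in> J \<Longrightarrow> f i j \<in> carrier G"
  shows "(\<Oplus>i\<in>I. \<Oplus>j\<in>J. f i j) = (\<Oplus>j\<in>J. \<Oplus>i\<in>I. f i j)"
  using assms(1,3)
proof (induction I rule: finite_induct)
  case (insert a I)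
  have "(\<Oplus>i\<in>insert a I. \<Oplus>j\<in>J. f i j) = (\<Oplus>j\<in>J. f a j) \<oplus> (\<Oplus>i\<in>I. \<Oplus>j\<in>J. f i j)"
    using insert by (intro finsum_insert) (auto intro!: finsum_closed)
  also have "\<dots> = (\<Oplus>j\<in>J. f a j \<oplus> (\<Oplus>i\<in>I. f i j))"
    using insert by (subst finsum_addf) (auto intro!: finsum_closed)
  also have "\<dots> = (\<Oplus>j\<in>J. \<Oplus>i\<in>insert a I. f i j)"
    using insert by (intro finsum_cong') (auto intro!: finsum_closed)
  finally show ?case .
qed (simp add: finsum_zero)

lemma (in abelian_monoid) finsum_cartesian:
  assumes "finite I" "finite J" "\<And>i j. i \<in> I \<Longrightarrow> j \<in> J \<Longrightarrow> f i j \<in> carrier G"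
  shows "(\<Oplus>p\<in>I \<times> J. f (fst p) (snd p)) = (\<Oplus>i\<in>I. \<Oplus>j\<in>J. f i j)"
  using assms(1,3)
proof (induction I rule: finite_induct)
  case (insert a I)
  have "insert a I \<times> J = Pair a ` J \<union> I \<times> J" by auto
  then have "(\<Oplus>p\<in>insert a I \<times> J. f (fst p) (snd p))
      = (\<Oplus>p\<in>Pair a ` J. f (fst p) (snd p)) \<oplus> (\<Oplus>p\<in>I \<times> J. f (fst p) (snd p))"
    using insert assms(2) by (simp only:, intro finsum_Un_disjoint) auto
  also have "(\<Oplus>p\<in>Pair a ` J. f (fst p) (snd p)) = (\<Oplus>j\<in>J. f a j)"
    using insert by (subst finsum_reindex) (auto intro: inj_onI)
  also have "(\<Oplus>p\<in>I \<times> J. f (fst p) (snd p)) = (\<Oplus>i\<in>I. \<Oplus>j\<in>J. f i j)"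
    using insert by simp
  also have "(\<Oplus>j\<in>J. f a j) \<oplus> (\<Oplus>i\<in>I. \<Oplus>j\<in>J. f i j) = (\<Oplus>i\<in>insert a I. \<Oplus>j\<in>J. f i j)"
    using insert by (intro finsum_insert[symmetric]) (auto intro!: finsum_closed)
  finally show ?case .
qed simp

lemma (in abelian_group) finsum_minus:
  assumes "finite I" "f \<in> I \<rightarrow> carrier G" "g \<in> I \<rightarrow> carrier G"
  shows "(\<Oplus>i\<in>I. f i \<ominus> g i) = (\<Oplus>i\<in>I. f i) \<ominus> (\<Oplus>i\<in>I. g i)"
  using assms
proof (induction I rule: finite_induct)
  case empty
  then show ?case by (simp add: minus_eq r_neg)
next
  case (insert a I)
  then have *: "f a \<in> carrier G" "g a \<in> carrier G" "(\<Oplus>i\<in>I. f i) \<in> carrier G" "(\<Oplus>i\<in>I. g i) \<in> carrier G"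
    by (auto intro!: finsum_closed)
  have "(\<Oplus>i\<in>insert a I. f i \<ominus> g i) = (f a \<ominus> g a) \<oplus> ((\<Oplus>i\<in>I. f i) \<ominus> (\<Oplus>i\<in>I. g i))"
    using insert by (subst finsum_insert) (auto simp: Pi_iff)
  then show ?case using insert * by (simp add: minus_eq minus_add a_ac Pi_iff)
qed

text \<open>Lagrange in the additive group: the order of the group annihilates every
  element.\<close>

lemma (in ring) finsum_const_card:
  assumes "finite (carrier R)" "a \<in> carrier R" "card I = card (carrier R)"
  shows "(\<Oplus>i\<in>I. a) = \<zero>"
proof -
  have "[card (carrier R)] \<cdot> a = \<zero>"
    using add.pow_order_eq_1[of a] assms by (simp add: order_def add_pow_def)
  then show ?thesis using add.finprod_const[of a I] assms by simp
qed

section \<open>Monoid rings and quotients\<close>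

context monoid
begin

definition conv :: "('a \<Rightarrow> int) \<Rightarrow> ('a \<Rightarrow> int) \<Rightarrow> 'a \<Rightarrow> int" where
  "conv f g = (\<lambda>w. \<Sum>x | f x \<noteq> 0. \<Sum>y | g y \<noteq> 0. if x \<otimes> y = w then f x * g y else 0)"

lemma monoid_ring_simps:
  "f \<in> carrier (monoid_ring G) \<longleftrightarrow> finite {x. f x \<noteq> 0} \<and> {x. f x \<noteq> 0} \<subseteq> carrier G"
  "f \<otimes>\<^bsub>monoid_ring G\<^esub> g = conv f g"
  "\<one>\<^bsub>monoid_ring G\<^esub> = monom \<one>"
  "\<zero>\<^bsub>monoid_ring G\<^esub> = (\<lambda>w. 0)"
  "f \<oplus>\<^bsub>monoid_ring G\<^esub> g = (\<lambda>w. f w + g w)"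
  by (simp_all add: monoid_ring_def monom_def conv_def)

text \<open>Enlarging the supports to arbitrary finite sets adds only zero terms, and allows several
  convolutions to be compared over common index sets.\<close>

lemma conv_eq:
  assumes "finite S" "{x. f x \<noteq> 0} \<subseteq> S" "finite T" "{x. g x \<noteq> 0} \<subseteq> T"
  shows "conv f g w = (\<Sum>x\<in>S. \<Sum>y\<in>T. if x \<otimes> y = w then f x * g y else 0)"
proof -
  have "conv f g w = (\<Sum>x | f x \<noteq> 0. \<Sum>y\<in>T. if x \<otimes> y = w then f x * g y else 0)"
    unfolding conv_def using assms by (intro sum.cong sum.mono_neutral_left) auto
  also have "\<dots> = (\<Sum>x\<in>S. \<Sum>y\<in>T. if x \<otimes> y = w then f x * g y else 0)"
    using assms by (intro sum.mono_neutral_left) (auto intro!: sum.neutral split: if_splits)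
  finally show ?thesis .
qed

lemma conv_support: "{w. conv f g w \<noteq> 0} \<subseteq> (\<lambda>(x, y). x \<otimes> y) ` ({x. f x \<noteq> 0} \<times> {y. g y \<noteq> 0})"
proof
  fix w assume "w \<in> {w. conv f g w \<noteq> 0}"
  then obtain x y where "f x \<noteq> 0" "g y \<noteq> 0" "x \<otimes> y = w"
    unfolding conv_def by (auto elim!: sum.not_neutral_contains_not_neutral split: if_splits)
  then show "w \<in> (\<lambda>(x, y). x \<otimes> y) ` ({x. f x \<noteq> 0} \<times> {y. g y \<noteq> 0})" by auto
qed

lemma conv_closed:
  assumes "f \<in> carrier (monoid_ring G)" "g \<in> carrier (monoid_ring G)"
  shows "conv f g \<in> carrier (monoid_ring G)"
  unfolding monoid_ring_simps
proof
  show "finite {x. conv f g x \<noteq> 0}"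
    using assms by (intro finite_subset[OF conv_support]) (auto simp: monoid_ring_simps)
  show "{x. conv f g x \<noteq> 0} \<subseteq> carrier G"
    using assms by (intro order_trans[OF conv_support]) (auto simp: monoid_ring_simps)
qed

text \<open>Every pair in \<open>S \<times> T\<close> has its product at exactly one
  \<open>v\<close> in \<open>V\<close>, so the sum over \<open>V\<close> collapses. With
  \<open>\<phi>\<close> chosen as a partial sum of \<open>h\<close> or as an indicator, this handles
  both bracketings in the proof of associativity.\<close>

lemma sum_conv:
  assumes "finite S" "{x. f x \<noteq> 0} \<subseteq> S" "finite T" "{x. g x \<noteq> 0} \<subseteq> T"
    and "finite V" "(\<lambda>(x, y). x \<otimes> y) ` (S \<times> T) \<subseteq> V"
  shows "(\<Sum>v\<in>V. conv f g v * \<phi> v) = (\<Sum>x\<in>S. \<Sum>y\<in>T. f x * g y * \<phi> (x \<otimes> y))"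
proof -
  have "(\<Sum>v\<in>V. conv f g v * \<phi> v)
      = (\<Sum>v\<in>V. \<Sum>x\<in>S. \<Sum>y\<in>T. if v = x \<otimes> y then f x * g y * \<phi> v else 0)"
    unfolding conv_eq[OF assms(1-4)] sum_distrib_right by (intro sum.cong refl) auto
  also have "\<dots> = (\<Sum>x\<in>S. \<Sum>v\<in>V. \<Sum>y\<in>T. if v = x \<otimes> y then f x * g y * \<phi> v else 0)"
    by (rule sum.swap)
  also have "\<dots> = (\<Sum>x\<in>S. \<Sum>y\<in>T. \<Sum>v\<in>V. if v = x \<otimes> y then f x * g y * \<phi> v else 0)"
    by (intro sum.cong refl sum.swap)
  also have "\<dots> = (\<Sum>x\<in>S. \<Sum>y\<in>T. f x * g y * \<phi> (x \<otimes> y))"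
    using assms(5,6) by (intro sum.cong refl) (auto simp: sum.delta)
  finally show ?thesis .
qed

lemma conv_assoc:
  assumes "f \<in> carrier (monoid_ring G)" "g \<in> carrier (monoid_ring G)" "h \<in> carrier (monoid_ring G)"
  shows "conv (conv f g) h = conv f (conv g h)"
proof
  fix w
  define S T U where "S = {x. f x \<noteq> 0}" and "T = {x. g x \<noteq> 0}" and "U = {x. h x \<noteq> 0}"
  have fin: "finite S" "finite T" "finite U"
    and sub: "S \<subseteq> carrier G" "T \<subseteq> carrier G" "U \<subseteq> carrier G"
    using assms by (auto simp: S_def T_def U_def monoid_ring_simps)
  define V W where "V = (\<lambda>(x, y). x \<otimes> y) ` (S \<times> T)" and "W = (\<lambda>(x, y). x \<otimes> y) ` (T \<times> U)"
  have finVW: "finite V" "finite W" using fin by (auto simp: V_def W_def)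
  have "conv (conv f g) h w = (\<Sum>v\<in>V. \<Sum>z\<in>U. if v \<otimes> z = w then conv f g v * h z else 0)"
    using finVW fin conv_support[of f g] by (intro conv_eq) (auto simp: V_def S_def T_def U_def)
  also have "\<dots> = (\<Sum>v\<in>V. conv f g v * (\<Sum>z\<in>U. if v \<otimes> z = w then h z else 0))"
    unfolding sum_distrib_left by (intro sum.cong refl) auto
  also have "\<dots> = (\<Sum>x\<in>S. \<Sum>y\<in>T. f x * g y * (\<Sum>z\<in>U. if x \<otimes> y \<otimes> z = w then h z else 0))"
    using fin finVW by (intro sum_conv) (auto simp: V_def S_def T_def)
  also have "\<dots> = (\<Sum>x\<in>S. f x * (\<Sum>y\<in>T. \<Sum>z\<in>U. g y * h z * (if x \<otimes> (y \<otimes> z) = w then 1 else 0)))"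
    unfolding sum_distrib_left using sub by (intro sum.cong refl) (auto simp: m_assoc subset_iff)
  also have "\<dots> = (\<Sum>x\<in>S. f x * (\<Sum>v\<in>W. conv g h v * (if x \<otimes> v = w then 1 else 0)))"
    using fin finVW
    by (intro sum.cong refl arg_cong2[where f = "(*)"] sum_conv[symmetric]) (auto simp: W_def T_def U_def)
  also have "\<dots> = (\<Sum>x\<in>S. \<Sum>v\<in>W. if x \<otimes> v = w then f x * conv g h v else 0)"
    unfolding sum_distrib_left by (intro sum.cong refl) auto
  also have "\<dots> = conv f (conv g h) w"
    using finVW fin conv_support[of g h] by (intro conv_eq[symmetric]) (auto simp: W_def S_def T_def U_def)
  finally show "conv (conv f g) h w = conv f (conv g h) w" .
qed

lemma monom_closed: "x \<in> carrier G \<Longrightarrow> monom x \<in> carrier (monoid_ring G)"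
  by (auto simp: monoid_ring_simps monom_def)

lemma conv_monom: "conv (monom x) (monom y) = monom (x \<otimes> y)"
  by (rule ext, subst conv_eq[of "{x}" _ "{y}"]) (auto simp: monom_def)

lemma conv_monom_left:
  assumes "f \<in> carrier (monoid_ring G)" shows "conv (monom \<one>) f = f"
proof
  fix w
  have f: "finite {x. f x \<noteq> 0}" "{x. f x \<noteq> 0} \<subseteq> carrier G"
    using assms by (auto simp: monoid_ring_simps)
  have "conv (monom \<one>) f w = (\<Sum>y | f y \<noteq> 0. if \<one> \<otimes> y = w then f y else 0)"
    using f by (subst conv_eq[of "{\<one>}" _ "{x. f x \<noteq> 0}"]) (auto simp: monom_def intro!: sum.cong)
  also have "\<dots> = (\<Sum>y | f y \<noteq> 0. if y = w then f y else 0)"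
    using f by (intro sum.cong) auto
  finally show "conv (monom \<one>) f w = f w" using f by (auto simp: sum.delta)
qed

lemma conv_monom_right:
  assumes "f \<in> carrier (monoid_ring G)" shows "conv f (monom \<one>) = f"
proof
  fix w
  have f: "finite {x. f x \<noteq> 0}" "{x. f x \<noteq> 0} \<subseteq> carrier G"
    using assms by (auto simp: monoid_ring_simps)
  have "conv f (monom \<one>) w = (\<Sum>x | f x \<noteq> 0. if x \<otimes> \<one> = w then f x else 0)"
    using f by (subst conv_eq[of "{x. f x \<noteq> 0}" _ "{\<one>}"]) (auto simp: monom_def intro!: sum.cong)
  also have "\<dots> = (\<Sum>x | f x \<noteq> 0. if x = w then f x else 0)"
    using f by (intro sum.cong) auto
  finally show "conv f (monom \<one>) w = f w" using f by (auto simp: sum.delta)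
qed

lemma monoid_ring_ring: "ring (monoid_ring G)"
proof (rule ringI)
  have fin2: "finite {x. f x + g x \<noteq> 0}" "{x. f x + g x \<noteq> 0} \<subseteq> carrier G"
    if "f \<in> carrier (monoid_ring G)" "g \<in> carrier (monoid_ring G)" for f g :: "'a \<Rightarrow> int"
  proof -
    have *: "{x. f x + g x \<noteq> 0} \<subseteq> {x. f x \<noteq> 0} \<union> {x. g x \<noteq> 0}" by auto
    then show "finite {x. f x + g x \<noteq> 0}"
      using that by (intro finite_subset[OF *]) (auto simp: monoid_ring_simps)
    show "{x. f x + g x \<noteq> 0} \<subseteq> carrier G"
      using that by (intro order_trans[OF *]) (auto simp: monoid_ring_simps)
  qed
  show "abelian_group (monoid_ring G)"
  proof (rule abelian_groupI)
    fix f assume "f \<in> carrier (monoid_ring G)"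
    then show "\<exists>g\<in>carrier (monoid_ring G). g \<oplus>\<^bsub>monoid_ring G\<^esub> f = \<zero>\<^bsub>monoid_ring G\<^esub>"
      by (intro bexI[of _ "\<lambda>x. - f x"]) (auto simp: monoid_ring_simps)
  qed (use fin2 in \<open>auto simp: monoid_ring_simps\<close>)
  show "Group.monoid (monoid_ring G)"
    by (rule monoidI)
      (simp_all add: monoid_ring_simps(2,3) conv_closed monom_closed conv_assoc conv_monom_left
        conv_monom_right)
  fix f g h :: "'a \<Rightarrow> int"
  assume carr: "f \<in> carrier (monoid_ring G)" "g \<in> carrier (monoid_ring G)" "h \<in> carrier (monoid_ring G)"
  let ?S = "\<lambda>f. {x. f x \<noteq> 0}"
  have fin: "finite (?S f)" "finite (?S g)" "finite (?S h)"
    using carr by (auto simp: monoid_ring_simps)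
  show "(f \<oplus>\<^bsub>monoid_ring G\<^esub> g) \<otimes>\<^bsub>monoid_ring G\<^esub> h
      = f \<otimes>\<^bsub>monoid_ring G\<^esub> h \<oplus>\<^bsub>monoid_ring G\<^esub> g \<otimes>\<^bsub>monoid_ring G\<^esub> h"
    unfolding monoid_ring_simps
  proof
    fix w
    show "conv (\<lambda>w. f w + g w) h w = conv f h w + conv g h w"
      using fin
      \<comment> \<open>The union of the supports is a common index set for \<open>f\<close>,
        \<open>g\<close> and their sum, whose support may shrink by cancellation.\<close>
      by (subst (1 2 3) conv_eq[of "?S f \<union> ?S g" _ "?S h"])
        (auto simp: sum.distrib[symmetric] distrib_right intro!: sum.cong)
  qed
  show "h \<otimes>\<^bsub>monoid_ring G\<^esub> (f \<oplus>\<^bsub>monoid_ring G\<^esub> g)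
      = h \<otimes>\<^bsub>monoid_ring G\<^esub> f \<oplus>\<^bsub>monoid_ring G\<^esub> h \<otimes>\<^bsub>monoid_ring G\<^esub> g"
    unfolding monoid_ring_simps
  proof
    fix w
    show "conv h (\<lambda>w. f w + g w) w = conv h f w + conv h g w"
      using fin
      by (subst (1 2 3) conv_eq[of "?S h" _ "?S f \<union> ?S g"])
        (auto simp: sum.distrib[symmetric] distrib_left intro!: sum.cong)
  qed
qed

end

text \<open>Serves the exterior algebra, the Orlik-Solomon algebra and the tensor product alike:
  each is a quotient by a generated ideal and is entered through its coset homomorphism and the
  vanishing of the generators.\<close>

lemma (in ring) Quot_genideal:
  assumes "S \<subseteq> carrier R"
  shows "ring_hom_ring R (R Quot (Idl S)) ((+>) (Idl S))"
    and "a \<in> S \<Longrightarrow> Idl S +> a = \<zero>\<^bsub>R Quot (Idl S)\<^esub>"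
proof -
  interpret I: ideal "Idl S" R by (rule genideal_ideal[OF assms])
  show "ring_hom_ring R (R Quot (Idl S)) ((+>) (Idl S))" by (rule I.rcos_ring_hom_ring)
  show "Idl S +> a = \<zero>\<^bsub>R Quot (Idl S)\<^esub>" if "a \<in> S"
    using that genideal_self[OF assms] assms a_coset_join2[OF _ I.a_subgroup]
    by (auto simp: FactRing_def)
qed

section \<open>The exterior and Orlik-Solomon algebras\<close>

lemma monoid_free_monoid: "Group.monoid (free_monoid V)"
  by (rule monoidI) (auto simp: free_monoid_def)

lemma tensor_algebra_ring: "ring (tensor_algebra V)"
  unfolding tensor_algebra_def by (rule monoid.monoid_ring_ring[OF monoid_free_monoid])

lemma exterior_hom:
  "ring_hom_ring (tensor_algebra V) (exterior_algebra V) ((+>\<^bsub>tensor_algebra V\<^esub>) (exterior_ideal V))"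
  "x \<in> tensor_degree_one V \<Longrightarrow>
    exterior_ideal V +>\<^bsub>tensor_algebra V\<^esub> (x \<otimes>\<^bsub>tensor_algebra V\<^esub> x) = \<zero>\<^bsub>exterior_algebra V\<^esub>"
proof -
  interpret T: ring "tensor_algebra V" by (rule tensor_algebra_ring)
  have *: "{x \<otimes>\<^bsub>tensor_algebra V\<^esub> x | x. x \<in> tensor_degree_one V} \<subseteq> carrier (tensor_algebra V)"
    by (auto simp: tensor_degree_one_def)
  show "ring_hom_ring (tensor_algebra V) (exterior_algebra V) ((+>\<^bsub>tensor_algebra V\<^esub>) (exterior_ideal V))"
    unfolding exterior_algebra_def exterior_ideal_def by (rule T.Quot_genideal(1)[OF *])
  show "exterior_ideal V +>\<^bsub>tensor_algebra V\<^esub> (x \<otimes>\<^bsub>tensor_algebra V\<^esub> x) = \<zero>\<^bsub>exterior_algebra V\<^esub>"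
    if "x \<in> tensor_degree_one V"
    unfolding exterior_algebra_def exterior_ideal_def by (rule T.Quot_genideal(2)[OF *]) (use that in auto)
qed

lemma exterior_algebra_ring: "ring (exterior_algebra V)"
  using exterior_hom(1) by (rule ring_hom_ring.axioms)

lemma monom_degree_one: "u \<in> V \<Longrightarrow> monom [u] \<in> tensor_degree_one V"
  by (auto simp: tensor_degree_one_def tensor_algebra_def free_monoid_def monoid_ring_def monom_def)

lemma exterior_gen_closed:
  assumes "u \<in> V" shows "exterior_gen V u \<in> carrier (exterior_algebra V)"
proof -
  have "monom [u] \<in> carrier (tensor_algebra V)"
    using monom_degree_one[OF assms] by (simp add: tensor_degree_one_def)
  then show ?thesis
    unfolding exterior_gen_def by (rule ring_hom_closed[OF ring_hom_ring.homh[OF exterior_hom(1)]])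
qed

lemma exterior_gen_square:
  assumes "u \<in> V"
  shows "exterior_gen V u \<otimes>\<^bsub>exterior_algebra V\<^esub> exterior_gen V u = \<zero>\<^bsub>exterior_algebra V\<^esub>"
proof -
  interpret h: ring_hom_ring "tensor_algebra V" "exterior_algebra V"
    "(+>\<^bsub>tensor_algebra V\<^esub>) (exterior_ideal V)" by (rule exterior_hom)
  show ?thesis
    using exterior_hom(2)[OF monom_degree_one[OF assms]] monom_degree_one[OF assms]
    by (simp add: exterior_gen_def tensor_degree_one_def)
qed

text \<open>Polarisation: expand the square of the degree-one element \<open>monom [u]\<close> plus
  \<open>monom [v]\<close>, which vanishes along with the squares of both summands.\<close>

lemma exterior_gen_anticommute:
  assumes "u \<in> V" "v \<in> V"
  shows "exterior_gen V u \<otimes>\<^bsub>exterior_algebra V\<^esub> exterior_gen V v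
    = \<ominus>\<^bsub>exterior_algebra V\<^esub> (exterior_gen V v \<otimes>\<^bsub>exterior_algebra V\<^esub> exterior_gen V u)"
proof -
  interpret h: ring_hom_ring "tensor_algebra V" "exterior_algebra V"
    "(+>\<^bsub>tensor_algebra V\<^esub>) (exterior_ideal V)" by (rule exterior_hom)
  let ?a = "exterior_gen V u" and ?b = "exterior_gen V v"
  have carr: "?a \<in> carrier (exterior_algebra V)" "?b \<in> carrier (exterior_algebra V)"
    by (rule assms[THEN exterior_gen_closed])+
  have mon: "monom [u] \<in> carrier (tensor_algebra V)" "monom [v] \<in> carrier (tensor_algebra V)"
    using assms[THEN monom_degree_one] by (simp_all add: tensor_degree_one_def)
  have "monom [u] \<oplus>\<^bsub>tensor_algebra V\<^esub> monom [v] \<in> tensor_degree_one V"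
    using assms monom_degree_one[of u V] monom_degree_one[of v V] h.R.a_closed
    by (auto simp: tensor_degree_one_def tensor_algebra_def monoid_ring_def)
       (metis add_0)
  from exterior_hom(2)[OF this]
  have "(?a \<oplus>\<^bsub>exterior_algebra V\<^esub> ?b) \<otimes>\<^bsub>exterior_algebra V\<^esub> (?a \<oplus>\<^bsub>exterior_algebra V\<^esub> ?b)
    = \<zero>\<^bsub>exterior_algebra V\<^esub>"
    using mon by (simp add: exterior_gen_def)
  then have "?a \<otimes>\<^bsub>exterior_algebra V\<^esub> ?b \<oplus>\<^bsub>exterior_algebra V\<^esub> ?b \<otimes>\<^bsub>exterior_algebra V\<^esub> ?a
    = \<zero>\<^bsub>exterior_algebra V\<^esub>"
    using carr assms[THEN exterior_gen_square] by (simp add: h.S.l_distr h.S.r_distr h.S.a_ac)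
  then show ?thesis using carr by (simp add: h.S.minus_equality)
qed

lemma exterior_prod_closed: "set s \<subseteq> V \<Longrightarrow> exterior_prod V s \<in> carrier (exterior_algebra V)"
proof (induction s)
  interpret ring "exterior_algebra V" by (rule exterior_algebra_ring)
  case (Cons u s)
  then show ?case using exterior_gen_closed[of u V] by simp
next
  interpret ring "exterior_algebra V" by (rule exterior_algebra_ring)
  case Nil
  show ?case by simp
qed

lemma boundary_prod_closed: "set s \<subseteq> V \<Longrightarrow> boundary_prod V s \<in> carrier (exterior_algebra V)"
proof (induction s)
  interpret ring "exterior_algebra V" by (rule exterior_algebra_ring)
  case (Cons u s)
  then show ?case using exterior_gen_closed[of u V] exterior_prod_closed[of s V] by simp
next
  interpret ring "exterior_algebra V" by (rule exterior_algebra_ring)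
  case Nil
  show ?case by simp
qed

section \<open>The Orlik-Solomon algebra\<close>

lemma (in matroid) os_hom:
  "ring_hom_ring (exterior_algebra E) os_algebra ((+>\<^bsub>exterior_algebra E\<^esub>) os_ideal)"
  "distinct s \<Longrightarrow> circuit (set s) \<Longrightarrow>
    os_ideal +>\<^bsub>exterior_algebra E\<^esub> boundary_prod E s = \<zero>\<^bsub>os_algebra\<^esub>"
proof -
  interpret X: ring "exterior_algebra E" by (rule exterior_algebra_ring)
  have *: "{boundary_prod E s | s. distinct s \<and> circuit (set s)} \<subseteq> carrier (exterior_algebra E)"
    using boundary_prod_closed[of _ E] by (auto simp: circuit_def)
  show "ring_hom_ring (exterior_algebra E) os_algebra ((+>\<^bsub>exterior_algebra E\<^esub>) os_ideal)"
    unfolding os_algebra_def os_ideal_def by (rule X.Quot_genideal(1)[OF *])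
  show "os_ideal +>\<^bsub>exterior_algebra E\<^esub> boundary_prod E s = \<zero>\<^bsub>os_algebra\<^esub>"
    if "distinct s" "circuit (set s)"
    unfolding os_algebra_def os_ideal_def by (rule X.Quot_genideal(2)[OF *]) (use that in auto)
qed

lemma (in matroid) os_algebra_ring: "ring os_algebra"
  using os_hom(1) by (rule ring_hom_ring.axioms)

lemma (in matroid) os_gen_closed: "u \<in> E \<Longrightarrow> os_gen u \<in> carrier os_algebra"
  unfolding os_gen_def
  by (rule ring_hom_closed[OF ring_hom_ring.homh[OF os_hom(1)] exterior_gen_closed])

lemma (in matroid) os_gen_square:
  assumes "u \<in> E" shows "os_gen u \<otimes>\<^bsub>os_algebra\<^esub> os_gen u = \<zero>\<^bsub>os_algebra\<^esub>"
proof -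
  interpret h: ring_hom_ring "exterior_algebra E" os_algebra "(+>\<^bsub>exterior_algebra E\<^esub>) os_ideal"
    by (rule os_hom)
  show ?thesis
    unfolding os_gen_def using exterior_gen_closed[OF assms] exterior_gen_square[OF assms]
    by (simp flip: h.hom_mult)
qed

lemma (in matroid) os_gen_anticommute:
  assumes "u \<in> E" "v \<in> E"
  shows "os_gen u \<otimes>\<^bsub>os_algebra\<^esub> os_gen v = \<ominus>\<^bsub>os_algebra\<^esub> (os_gen v \<otimes>\<^bsub>os_algebra\<^esub> os_gen u)"
proof -
  interpret h: ring_hom_ring "exterior_algebra E" os_algebra "(+>\<^bsub>exterior_algebra E\<^esub>) os_ideal"
    by (rule os_hom)
  show ?thesis
    unfolding os_gen_def using assms[THEN exterior_gen_closed] exterior_gen_anticommute[OF assms]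
    by (simp flip: h.hom_mult h.hom_a_inv)
qed

text \<open>For three distinct points this is the relation of the circuit \<open>{x, u, v}\<close>,
  whose boundary is \<open>e_u e_v - e_x (e_v - e_u)\<close>. If two of the points coincide, it
  follows from vanishing squares and anticommutation.\<close>

lemma (in simple_matroid) os_gen_line:
  assumes X: "X \<in> L2" and x: "x \<in> X" and u: "u \<in> X" and v: "v \<in> X"
  shows "os_gen u \<otimes>\<^bsub>os_algebra\<^esub> os_gen v
    = os_gen x \<otimes>\<^bsub>os_algebra\<^esub> os_gen v \<ominus>\<^bsub>os_algebra\<^esub> os_gen x \<otimes>\<^bsub>os_algebra\<^esub> os_gen u"
proof -
  interpret h: ring_hom_ring "exterior_algebra E" os_algebra "(+>\<^bsub>exterior_algebra E\<^esub>) os_ideal"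
    by (rule os_hom)
  have E: "x \<in> E" "u \<in> E" "v \<in> E" using L2_subset[OF X] x u v by auto
  note carr = E[THEN os_gen_closed] E[THEN exterior_gen_closed]
  consider "u = v" | "x = u" | "x = v" | "distinct [x, u, v]" by auto
  then show ?thesis
  proof cases
    case 4
    let ?x = "exterior_gen E x" and ?u = "exterior_gen E u" and ?v = "exterior_gen E v"
    have "circuit (set [x, u, v])" using line_circuit[OF X x u v 4] by simp
    from os_hom(2)[OF 4 this] have "os_ideal +>\<^bsub>exterior_algebra E\<^esub>
      (?u \<otimes>\<^bsub>exterior_algebra E\<^esub> ?v \<ominus>\<^bsub>exterior_algebra E\<^esub>
        ?x \<otimes>\<^bsub>exterior_algebra E\<^esub> (?v \<ominus>\<^bsub>exterior_algebra E\<^esub> ?u)) = \<zero>\<^bsub>os_algebra\<^esub>"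
      using carr by (simp add: h.R.minus_eq)
    then have "os_gen u \<otimes>\<^bsub>os_algebra\<^esub> os_gen v \<ominus>\<^bsub>os_algebra\<^esub>
       os_gen x \<otimes>\<^bsub>os_algebra\<^esub> (os_gen v \<ominus>\<^bsub>os_algebra\<^esub> os_gen u) = \<zero>\<^bsub>os_algebra\<^esub>"
      using carr by (simp add: os_gen_def h.R.minus_eq h.S.minus_eq)
    then have "os_gen u \<otimes>\<^bsub>os_algebra\<^esub> os_gen v
      = os_gen x \<otimes>\<^bsub>os_algebra\<^esub> (os_gen v \<ominus>\<^bsub>os_algebra\<^esub> os_gen u)"
      using carr by (simp add: h.S.r_right_minus_eq)
    then show ?thesis using carr by (simp add: h.S.minus_eq h.S.r_distr h.S.r_minus)
  next
    case 1
    then show ?thesis using carr os_gen_square E by (simp add: h.S.minus_eq h.S.r_neg)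
  next
    case 2
    then show ?thesis using carr os_gen_square E by (simp add: h.S.minus_eq)
  next
    case 3
    then show ?thesis using carr os_gen_square[of v] os_gen_anticommute[of u v] E
      by (simp add: h.S.minus_eq)
  qed
qed

section \<open>Tensor products\<close>

locale two_rings = A: ring A + K: ring K for A :: "('a, 'x) ring_scheme" and K :: "('b, 'y) ring_scheme"
begin

abbreviation T where "T \<equiv> tensor_ring A K"
abbreviation pt where "pt \<equiv> pure_tensor A K"
abbreviation F where "F \<equiv> monoid_ring (A \<times>\<times> K)"

lemma monoid_pairs: "Group.monoid (A \<times>\<times> K)"
  by (intro DirProd_monoid) unfold_locales

sublocale F: ring F
  by (rule monoid.monoid_ring_ring[OF monoid_pairs])

lemma monom_pair_closed [simp]: "a \<in> carrier A \<Longrightarrow> x \<in> carrier K \<Longrightarrow> monom (a, x) \<in> carrier F"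
  using monoid.monom_closed[OF monoid_pairs] by simp

lemma tensor_quotient:
  "ring_hom_ring F T ((+>\<^bsub>F\<^esub>) (tensor_ideal A K))"
  "\<lbrakk>a \<in> carrier A; b \<in> carrier A; x \<in> carrier K\<rbrakk> \<Longrightarrow> tensor_ideal A K +>\<^bsub>F\<^esub>
     (monom (a \<oplus>\<^bsub>A\<^esub> b, x) \<ominus>\<^bsub>F\<^esub> (monom (a, x) \<oplus>\<^bsub>F\<^esub> monom (b, x))) = \<zero>\<^bsub>T\<^esub>"
  "\<lbrakk>a \<in> carrier A; x \<in> carrier K; y \<in> carrier K\<rbrakk> \<Longrightarrow> tensor_ideal A K +>\<^bsub>F\<^esub>
     (monom (a, x \<oplus>\<^bsub>K\<^esub> y) \<ominus>\<^bsub>F\<^esub> (monom (a, x) \<oplus>\<^bsub>F\<^esub> monom (a, y))) = \<zero>\<^bsub>T\<^esub>"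
proof -
  let ?S = "{monom (a \<oplus>\<^bsub>A\<^esub> b, x) \<ominus>\<^bsub>F\<^esub> (monom (a, x) \<oplus>\<^bsub>F\<^esub> monom (b, x)) | a b x.
          a \<in> carrier A \<and> b \<in> carrier A \<and> x \<in> carrier K} \<union>
       {monom (a, x \<oplus>\<^bsub>K\<^esub> y) \<ominus>\<^bsub>F\<^esub> (monom (a, x) \<oplus>\<^bsub>F\<^esub> monom (a, y)) | a x y.
          a \<in> carrier A \<and> x \<in> carrier K \<and> y \<in> carrier K}"
  have S: "?S \<subseteq> carrier F" by auto
  have I: "tensor_ideal A K = Idl\<^bsub>F\<^esub> ?S" by (simp add: tensor_ideal_def Let_def)
  have Q: "T = F Quot (Idl\<^bsub>F\<^esub> ?S)" by (simp add: tensor_ring_def I)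
  show "ring_hom_ring F T ((+>\<^bsub>F\<^esub>) (tensor_ideal A K))"
    unfolding Q I by (rule F.Quot_genideal(1)[OF S])
  show "tensor_ideal A K +>\<^bsub>F\<^esub>
     (monom (a \<oplus>\<^bsub>A\<^esub> b, x) \<ominus>\<^bsub>F\<^esub> (monom (a, x) \<oplus>\<^bsub>F\<^esub> monom (b, x))) = \<zero>\<^bsub>T\<^esub>"
    if "a \<in> carrier A" "b \<in> carrier A" "x \<in> carrier K"
    unfolding Q I by (rule F.Quot_genideal(2)[OF S]) (use that in blast)
  show "tensor_ideal A K +>\<^bsub>F\<^esub>
     (monom (a, x \<oplus>\<^bsub>K\<^esub> y) \<ominus>\<^bsub>F\<^esub> (monom (a, x) \<oplus>\<^bsub>F\<^esub> monom (a, y))) = \<zero>\<^bsub>T\<^esub>"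
    if "a \<in> carrier A" "x \<in> carrier K" "y \<in> carrier K"
    unfolding Q I by (rule F.Quot_genideal(2)[OF S]) (use that in blast)
qed

sublocale q: ring_hom_ring F T "(+>\<^bsub>F\<^esub>) (tensor_ideal A K)"
  by (rule tensor_quotient)

lemma pt_closed [simp]: "a \<in> carrier A \<Longrightarrow> x \<in> carrier K \<Longrightarrow> pt a x \<in> carrier T"
  by (simp add: pure_tensor_def)

lemma pt_mult:
  assumes "a \<in> carrier A" "b \<in> carrier A" "x \<in> carrier K" "y \<in> carrier K"
  shows "pt a x \<otimes>\<^bsub>T\<^esub> pt b y = pt (a \<otimes>\<^bsub>A\<^esub> b) (x \<otimes>\<^bsub>K\<^esub> y)"
  using assms monoid.conv_monom[OF monoid_pairs, of "(a, x)" "(b, y)"]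
  by (simp add: pure_tensor_def monoid.monoid_ring_simps(2)[OF monoid_pairs] flip: q.hom_mult)

lemma pt_add_left:
  assumes "a \<in> carrier A" "b \<in> carrier A" "x \<in> carrier K"
  shows "pt (a \<oplus>\<^bsub>A\<^esub> b) x = pt a x \<oplus>\<^bsub>T\<^esub> pt b x"
  using tensor_quotient(2)[OF assms] assms
  by (simp add: pure_tensor_def F.minus_eq flip: q.S.minus_eq)

lemma pt_add_right:
  assumes "a \<in> carrier A" "x \<in> carrier K" "y \<in> carrier K"
  shows "pt a (x \<oplus>\<^bsub>K\<^esub> y) = pt a x \<oplus>\<^bsub>T\<^esub> pt a y"
  using tensor_quotient(3)[OF assms] assms
  by (simp add: pure_tensor_def F.minus_eq flip: q.S.minus_eq)

lemma pt_zero_left [simp]: "x \<in> carrier K \<Longrightarrow> pt \<zero>\<^bsub>A\<^esub> x = \<zero>\<^bsub>T\<^esub>"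
  using pt_add_left[of "\<zero>\<^bsub>A\<^esub>" "\<zero>\<^bsub>A\<^esub>" x] by simp

lemma pt_zero_right [simp]: "a \<in> carrier A \<Longrightarrow> pt a \<zero>\<^bsub>K\<^esub> = \<zero>\<^bsub>T\<^esub>"
  using pt_add_right[of a "\<zero>\<^bsub>K\<^esub>" "\<zero>\<^bsub>K\<^esub>"] by simp

lemma pt_minus_left:
  assumes "a \<in> carrier A" "b \<in> carrier A" "x \<in> carrier K"
  shows "pt (a \<ominus>\<^bsub>A\<^esub> b) x = pt a x \<ominus>\<^bsub>T\<^esub> pt b x"
proof -
  have "pt (\<ominus>\<^bsub>A\<^esub> b) x \<oplus>\<^bsub>T\<^esub> pt b x = \<zero>\<^bsub>T\<^esub>"
    using assms by (simp add: A.l_neg flip: pt_add_left)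
  then show ?thesis using assms by (simp add: A.minus_eq q.S.minus_eq pt_add_left q.S.minus_equality)
qed

lemma pt_finsum_right:
  assumes "finite I" "a \<in> carrier A" "f \<in> I \<rightarrow> carrier K"
  shows "pt a (\<Oplus>\<^bsub>K\<^esub>i\<in>I. f i) = (\<Oplus>\<^bsub>T\<^esub>i\<in>I. pt a (f i))"
  using assms by (induction I rule: finite_induct) (auto simp: pt_add_right Pi_iff)

text \<open>Writing \<open>f\<^sub>i\<close> for \<open>e\<^sub>x e\<^sub>i\<close>, the double sum equals
  \<open>\<Sum>\<^sub>j f\<^sub>j \<otimes> |X| \<tau>\<^sub>j - \<Sum>\<^sub>i f\<^sub>i \<otimes> \<Sum>\<^sub>j \<tau>\<^sub>j\<close>.\<close>

lemma line_sum_zero: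
  assumes X: "finite X" "x \<in> X"
    and e: "\<And>i. i \<in> X \<Longrightarrow> e i \<in> carrier A"
    and rel: "\<And>i j. i \<in> X \<Longrightarrow> j \<in> X \<Longrightarrow>
      e i \<otimes>\<^bsub>A\<^esub> e j = e x \<otimes>\<^bsub>A\<^esub> e j \<ominus>\<^bsub>A\<^esub> e x \<otimes>\<^bsub>A\<^esub> e i"
    and \<tau>: "\<And>i. i \<in> X \<Longrightarrow> \<tau> i \<in> carrier K"
    and sum: "\<And>j. j \<in> X \<Longrightarrow> (\<Oplus>\<^bsub>K\<^esub>i\<in>X. \<tau> j) = (\<Oplus>\<^bsub>K\<^esub>i\<in>X. \<tau> i)"
  shows "(\<Oplus>\<^bsub>T\<^esub>i\<in>X. \<Oplus>\<^bsub>T\<^esub>j\<in>X. pt (e i \<otimes>\<^bsub>A\<^esub> e j) (\<tau> j)) = \<zero>\<^bsub>T\<^esub>"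
proof -
  define f where "f i = e x \<otimes>\<^bsub>A\<^esub> e i" for i
  have f: "f i \<in> carrier A" if "i \<in> X" for i using that X e by (simp add: f_def)
  have "(\<Oplus>\<^bsub>T\<^esub>i\<in>X. \<Oplus>\<^bsub>T\<^esub>j\<in>X. pt (e i \<otimes>\<^bsub>A\<^esub> e j) (\<tau> j))
    = (\<Oplus>\<^bsub>T\<^esub>i\<in>X. \<Oplus>\<^bsub>T\<^esub>j\<in>X. pt (f j) (\<tau> j) \<ominus>\<^bsub>T\<^esub> pt (f i) (\<tau> j))"
    using f \<tau> rel pt_minus_left[OF f f \<tau>] by (intro q.S.finsum_cong') (auto simp: f_def intro!: q.S.finsum_cong')
  also have "\<dots> = (\<Oplus>\<^bsub>T\<^esub>i\<in>X. \<Oplus>\<^bsub>T\<^esub>j\<in>X. pt (f j) (\<tau> j))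
      \<ominus>\<^bsub>T\<^esub> (\<Oplus>\<^bsub>T\<^esub>i\<in>X. \<Oplus>\<^bsub>T\<^esub>j\<in>X. pt (f i) (\<tau> j))"
    using X f \<tau> by (simp add: q.S.finsum_minus Pi_iff q.S.finsum_closed cong: q.S.finsum_cong)
  also have "(\<Oplus>\<^bsub>T\<^esub>i\<in>X. \<Oplus>\<^bsub>T\<^esub>j\<in>X. pt (f j) (\<tau> j)) = (\<Oplus>\<^bsub>T\<^esub>j\<in>X. \<Oplus>\<^bsub>T\<^esub>i\<in>X. pt (f j) (\<tau> j))"
    using X f \<tau> by (intro q.S.finsum_swap) auto
  also have "\<dots> = (\<Oplus>\<^bsub>T\<^esub>j\<in>X. pt (f j) (\<Oplus>\<^bsub>K\<^esub>i\<in>X. \<tau> j))"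
    using X f \<tau> by (intro q.S.finsum_cong') (auto simp: pt_finsum_right intro!: pt_closed K.finsum_closed)
  also have "\<dots> = (\<Oplus>\<^bsub>T\<^esub>j\<in>X. pt (f j) (\<Oplus>\<^bsub>K\<^esub>i\<in>X. \<tau> i))"
    using X f \<tau> sum by (intro q.S.finsum_cong') (auto intro!: pt_closed K.finsum_closed)
  also have "\<dots> = (\<Oplus>\<^bsub>T\<^esub>i\<in>X. \<Oplus>\<^bsub>T\<^esub>j\<in>X. pt (f i) (\<tau> j))"
    using X f \<tau> by (intro q.S.finsum_cong') (auto simp: pt_finsum_right intro!: q.S.finsum_closed)
  finally show ?thesis using X f \<tau> by (simp add: q.S.minus_eq q.S.r_neg q.S.finsum_closed Pi_iff)
qed

end

section \<open>Special functions are cocycles\<close>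

context simple_matroid
begin

text \<open>Two distinct points lie on exactly one line, so the sets \<open>D X\<close> of
  off-diagonal pairs, for \<open>X\<close> in \<open>L2\<close>, partition \<open>D E\<close>.
  Because the diagonal terms vanish, the full double sums over \<open>E\<close> and over each line
  equal their off-diagonal parts.\<close>

lemma finsum_pairs_by_lines:
  assumes G: "abelian_monoid G"
    and g: "\<And>u v. u \<in> E \<Longrightarrow> v \<in> E \<Longrightarrow> g u v \<in> carrier G"
    and diag: "\<And>u. u \<in> E \<Longrightarrow> g u u = \<zero>\<^bsub>G\<^esub>"
  shows "(\<Oplus>\<^bsub>G\<^esub>u\<in>E. \<Oplus>\<^bsub>G\<^esub>v\<in>E. g u v) = (\<Oplus>\<^bsub>G\<^esub>X\<in>L2. \<Oplus>\<^bsub>G\<^esub>u\<in>X. \<Oplus>\<^bsub>G\<^esub>v\<in>X. g u v)"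
proof -
  interpret abelian_monoid G by (rule G)
  let ?g = "\<lambda>p. g (fst p) (snd p)"
  define D where "D X = X \<times> X - Id" for X :: "'a set"
  have off_diag: "(\<Oplus>\<^bsub>G\<^esub>u\<in>X. \<Oplus>\<^bsub>G\<^esub>v\<in>X. g u v) = (\<Oplus>\<^bsub>G\<^esub>p\<in>D X. ?g p)" if X: "X \<subseteq> E" for X
  proof -
    have "(\<Oplus>\<^bsub>G\<^esub>u\<in>X. \<Oplus>\<^bsub>G\<^esub>v\<in>X. g u v) = (\<Oplus>\<^bsub>G\<^esub>p\<in>X \<times> X. ?g p)"
      using g subsetD[OF X] finite_subset[OF X finite_ground]
      by (intro finsum_cartesian[symmetric]) auto
    also have "\<dots> = (\<Oplus>\<^bsub>G\<^esub>p\<in>D X. ?g p)"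
      using g subsetD[OF X] diag finite_subset[OF X finite_ground]
      by (intro add.finprod_mono_neutral_cong_right) (auto simp: D_def)
    finally show ?thesis .
  qed
  have "D E = (\<Union>X\<in>L2. D X)"
  proof
    show "D E \<subseteq> (\<Union>X\<in>L2. D X)"
    proof
      fix p assume "p \<in> D E"
      then have p: "fst p \<in> E" "snd p \<in> E" "fst p \<noteq> snd p" by (auto simp: D_def)
      then have "p \<in> D (join (fst p) (snd p))"
        using in_join[OF p(1,2)] by (auto simp: D_def mem_Times_iff)
      then show "p \<in> (\<Union>X\<in>L2. D X)" using join_L2[OF p] by blast
    qed
    show "(\<Union>X\<in>L2. D X) \<subseteq> D E" using L2_subset by (auto simp: D_def)
  qed
  then have "(\<Oplus>\<^bsub>G\<^esub>p\<in>D E. ?g p) = (\<Oplus>\<^bsub>G\<^esub>p\<in>(\<Union>X\<in>L2. D X). ?g p)" by simp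
  also have "\<dots> = (\<Oplus>\<^bsub>G\<^esub>X\<in>L2. \<Oplus>\<^bsub>G\<^esub>p\<in>D X. ?g p)"
  proof (rule add.finprod_UN_disjoint[OF finite_L2])
    show "finite (D X)" if "X \<in> L2" for X using finite_line[OF that] by (simp add: D_def)
    show "pairwise (\<lambda>X Y. disjnt (D X) (D Y)) L2"
    proof (rule pairwiseI)
      fix X Y assume "X \<in> L2" "Y \<in> L2" "X \<noteq> Y"
      then show "disjnt (D X) (D Y)"
        using join_eq[of X] join_eq[of Y] by (fastforce simp: disjnt_iff D_def)
    qed
    show "?g p \<in> carrier G" if "X \<in> L2" "p \<in> D X" for X p
      using that L2_subset[OF that(1)] by (intro g) (auto simp: D_def)
  qed
  also have "\<dots> = (\<Oplus>\<^bsub>G\<^esub>X\<in>L2. \<Oplus>\<^bsub>G\<^esub>u\<in>X. \<Oplus>\<^bsub>G\<^esub>v\<in>X. g u v)"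
    using off_diag subsetD[OF L2_subset] g by (intro finsum_cong') (auto intro!: finsum_closed simp: L2_subset)
  finally show ?thesis using off_diag by simp
qed

theorem special_functions_subset_cocycles:
  assumes K: "ring K" and fin: "finite (carrier K)"
    and sum: "(\<Oplus>\<^bsub>K\<^esub>a\<in>carrier K. a) = \<zero>\<^bsub>K\<^esub>"
  shows "special_functions (carrier K) \<subseteq> cocycles K"
proof
  fix \<tau> assume special: "\<tau> \<in> special_functions (carrier K)"
  interpret two_rings os_algebra K
    using os_algebra_ring K by (intro two_rings.intro)
  have \<tau>_ext: "\<tau> \<in> E \<rightarrow>\<^sub>E carrier K" using special by (simp add: special_functions_def)
  then have \<tau>: "\<tau> u \<in> carrier K" if "u \<in> E" for u using that by blast
  note closed = os_gen_closed \<tau>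
  have line: "(\<Oplus>\<^bsub>T\<^esub>u\<in>X. \<Oplus>\<^bsub>T\<^esub>v\<in>X. pt (os_gen u \<otimes>\<^bsub>os_algebra\<^esub> os_gen v) (\<tau> v)) = \<zero>\<^bsub>T\<^esub>"
    if X: "X \<in> L2" for X
  proof -
    obtain x where x: "x \<in> X" using line_obtains_pair[OF X] .
    have XE: "X \<subseteq> E" by (rule L2_subset[OF X])
    have \<tau>X: "\<tau> u \<in> carrier K" if "u \<in> X" for u using that XE \<tau> by blast
    have "(\<Oplus>\<^bsub>K\<^esub>i\<in>X. \<tau> j) = (\<Oplus>\<^bsub>K\<^esub>i\<in>X. \<tau> i)" if j: "j \<in> X" for j
    proof -
      consider c where "\<forall>u\<in>X. \<tau> u = c" | "bij_betw \<tau> X (carrier K)"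
        using special X unfolding special_functions_def by blast
      then show ?thesis
      proof cases
        case 1
        then show ?thesis using j \<tau>X by (intro K.finsum_cong') auto
      next
        \<comment> \<open>Both sides vanish: the right one is the sum of all elements of
          \<open>K\<close>, and the left one repeats a fixed element as many times as
          \<open>K\<close> has elements.\<close>
        case 2
        then have "(\<Oplus>\<^bsub>K\<^esub>i\<in>X. \<tau> i) = (\<Oplus>\<^bsub>K\<^esub>a\<in>\<tau> ` X. a)"
          using \<tau>X by (intro K.finsum_reindex[symmetric]) (auto simp: bij_betw_def)
        also have "\<dots> = \<zero>\<^bsub>K\<^esub>" using 2 sum by (simp add: bij_betw_def)
        finally show ?thesis
          using K.finsum_const_card[OF fin \<tau>X[OF j] bij_betw_same_card[OF 2]] by simp
      qed
    qed
    then show ?thesis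
      using XE os_gen_closed \<tau>X os_gen_line[OF X x]
      by (intro line_sum_zero[OF finite_line[OF X] x]) auto
  qed
  \<comment> \<open>Distributivity turns the product into a double sum over \<open>E\<close>, which
    is then regrouped by lines.\<close>
  have "os_one_form K (\<lambda>u. \<one>\<^bsub>K\<^esub>) \<otimes>\<^bsub>T\<^esub> os_one_form K \<tau>
    = (\<Oplus>\<^bsub>T\<^esub>u\<in>E. pt (os_gen u) \<one>\<^bsub>K\<^esub> \<otimes>\<^bsub>T\<^esub> (\<Oplus>\<^bsub>T\<^esub>v\<in>E. pt (os_gen v) (\<tau> v)))"
    unfolding os_one_form_def using closed finite_ground
    by (intro q.S.finsum_ldistr) (auto intro!: q.S.finsum_closed)
  also have "\<dots> = (\<Oplus>\<^bsub>T\<^esub>u\<in>E. \<Oplus>\<^bsub>T\<^esub>v\<in>E. pt (os_gen u) \<one>\<^bsub>K\<^esub> \<otimes>\<^bsub>T\<^esub> pt (os_gen v) (\<tau> v))"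
    using closed finite_ground
    by (intro q.S.finsum_cong' q.S.finsum_rdistr) (auto intro!: q.S.finsum_closed)
  also have "\<dots> = (\<Oplus>\<^bsub>T\<^esub>u\<in>E. \<Oplus>\<^bsub>T\<^esub>v\<in>E. pt (os_gen u \<otimes>\<^bsub>os_algebra\<^esub> os_gen v) (\<tau> v))"
    using closed by (intro q.S.finsum_cong') (auto simp: pt_mult intro!: q.S.finsum_closed)
  also have "\<dots> = (\<Oplus>\<^bsub>T\<^esub>X\<in>L2. \<Oplus>\<^bsub>T\<^esub>u\<in>X. \<Oplus>\<^bsub>T\<^esub>v\<in>X. pt (os_gen u \<otimes>\<^bsub>os_algebra\<^esub> os_gen v) (\<tau> v))"
    using closed os_gen_square by (intro finsum_pairs_by_lines q.S.abelian_monoid_axioms) auto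
  also have "\<dots> = (\<Oplus>\<^bsub>T\<^esub>X\<in>L2. \<zero>\<^bsub>T\<^esub>)"
    using line by (intro q.S.finsum_cong') auto
  also have "\<dots> = \<zero>\<^bsub>T\<^esub>" by simp
  finally show "\<tau> \<in> cocycles K" using \<tau>_ext by (simp add: cocycles_def)
qed

end

section \<open>Finite fields\<close>

context cring
begin

theorem binomial_theorem:
  assumes [simp]: "x \<in> carrier R" "y \<in> carrier R"
  shows "(x \<oplus> y) [^] (n::nat) = (\<Oplus>i\<in>{..n}. [(n choose i)] \<cdot> (x [^] i \<otimes> y [^] (n - i)))"
proof (induction n)
  case (Suc n)
  \<comment> \<open>The exponents always have sum \<open>Suc n\<close>; only the row
    \<open>m\<close> of the binomial coefficient varies, so \<open>t n\<close> and
    \<open>t (Suc n)\<close> can be compared by Pascal's rule.\<close>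
  define t where "t m i = [(m choose i)] \<cdot> (x [^] i \<otimes> y [^] (Suc n - i))" for m i
  have t: "t m i \<in> carrier R" for m i by (simp add: t_def)
  define u where "u i = [(n choose i)] \<cdot> (x [^] Suc i \<otimes> y [^] (n - i))" for i
  have u: "u i \<in> carrier R" for i by (simp add: u_def)
  have x: "(\<Oplus>i\<in>{..n}. [(n choose i)] \<cdot> (x [^] i \<otimes> y [^] (n - i))) \<otimes> x = (\<Oplus>i\<in>{..n}. u i)"
    by (subst finsum_ldistr) (auto simp: u_def add_pow_ldistr add_pow_rdistr m_ac intro!: finsum_cong')
  have "(\<Oplus>i\<in>{..n}. [(n choose i)] \<cdot> (x [^] i \<otimes> y [^] (n - i))) \<otimes> y = (\<Oplus>i\<in>{..n}. t n i)"
    by (subst finsum_ldistr) (auto simp: t_def add_pow_ldistr m_assoc Suc_diff_le intro!: finsum_cong')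
  also have "\<dots> = (\<Oplus>i\<in>{..Suc n}. t n i)"
  proof -
    \<comment> \<open>The added top term is zero; it makes room for splitting off the term at index
      0 and shifting the others.\<close>
    have "t n (Suc n) = \<zero>" by (simp add: t_def binomial_eq_0)
    then show ?thesis using t by (simp add: finsum_Suc)
  qed
  also have "\<dots> = (\<Oplus>i\<in>{..n}. t n (Suc i)) \<oplus> t n 0"
    using t by (intro finsum_Suc2) auto
  finally have y: "(\<Oplus>i\<in>{..n}. [(n choose i)] \<cdot> (x [^] i \<otimes> y [^] (n - i))) \<otimes> y
    = (\<Oplus>i\<in>{..n}. t n (Suc i)) \<oplus> t n 0" .
  have "(x \<oplus> y) [^] Suc n = (\<Oplus>i\<in>{..n}. u i) \<oplus> ((\<Oplus>i\<in>{..n}. t n (Suc i)) \<oplus> t n 0)"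
    using Suc.IH by (simp add: r_distr x y)
  also have "\<dots> = (\<Oplus>i\<in>{..n}. u i \<oplus> t n (Suc i)) \<oplus> t n 0"
    using t u by (simp add: finsum_addf a_assoc finsum_closed Pi_iff)
  also have "(\<Oplus>i\<in>{..n}. u i \<oplus> t n (Suc i)) = (\<Oplus>i\<in>{..n}. t (Suc n) (Suc i))"
    using t u by (intro finsum_cong') (auto simp: u_def t_def add.nat_pow_mult)
  also have "t n 0 = t (Suc n) 0" by (simp add: t_def)
  also have "(\<Oplus>i\<in>{..n}. t (Suc n) (Suc i)) \<oplus> t (Suc n) 0 = (\<Oplus>i\<in>{..Suc n}. t (Suc n) i)"
    using t by (intro finsum_Suc2[symmetric]) auto
  finally show ?case by (simp add: t_def)
qed simp

lemma add_pow_eq_zero: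
  assumes "[(m::nat)] \<cdot> \<one> = \<zero>" "m dvd n" "a \<in> carrier R"
  shows "[n] \<cdot> a = \<zero>"
proof -
  obtain j where "n = m * j" using assms(2) by blast
  moreover have "[m] \<cdot> a = \<zero>" using add_pow_ldistr[of \<one> a m] assms by simp
  ultimately show ?thesis using assms(3) add.nat_pow_pow[of a j m] by simp
qed

context
  fixes p :: nat
  assumes p: "Factorial_Ring.prime p" and char_p: "[p] \<cdot> \<one> = \<zero>"
begin

text \<open>The prime \<open>p\<close> divides every binomial coefficient strictly between the ends
  of its row, so only the two outer terms survive.\<close>

lemma add_pow_prime:
  assumes [simp]: "x \<in> carrier R" "y \<in> carrier R"
  shows "(x \<oplus> y) [^] p = x [^] p \<oplus> y [^] p"
proof -
  have "(x \<oplus> y) [^] p = (\<Oplus>i\<in>{..p}. [(p choose i)] \<cdot> (x [^] i \<otimes> y [^] (p - i)))"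
    by (rule binomial_theorem) simp_all
  also have "\<dots> = (\<Oplus>i\<in>{0, p}. [(p choose i)] \<cdot> (x [^] i \<otimes> y [^] (p - i)))"
  proof (rule add.finprod_mono_neutral_cong_right)
    show "[(p choose i)] \<cdot> (x [^] i \<otimes> y [^] (p - i)) = \<zero>" if "i \<in> {..p} - {0, p}" for i
      using that p by (intro add_pow_eq_zero[OF char_p] dvd_choose_prime) auto
  qed auto
  also have "\<dots> = x [^] p \<oplus> y [^] p"
    using prime_gt_0_nat[OF p] by (simp add: a_comm)
  finally show ?thesis .
qed

lemma add_pow_prime_power:
  assumes [simp]: "x \<in> carrier R" "y \<in> carrier R"
  shows "(x \<oplus> y) [^] (p ^ s) = x [^] (p ^ s) \<oplus> y [^] (p ^ s)"
  by (induction s) (simp_all add: mult.commute[of p] add_pow_prime flip: nat_pow_pow)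

text \<open>Apply the additive identity to \<open>(x \<ominus> y) \<oplus> y\<close>; this avoids a
  discussion of the sign of a power of minus one.\<close>

lemma minus_pow_prime_power:
  assumes [simp]: "x \<in> carrier R" "y \<in> carrier R"
  shows "(x \<ominus> y) [^] (p ^ s) = x [^] (p ^ s) \<ominus> y [^] (p ^ s)"
proof -
  have "x [^] (p ^ s) = (x \<ominus> y) [^] (p ^ s) \<oplus> y [^] (p ^ s)"
    by (simp add: minus_eq a_assoc l_neg flip: add_pow_prime_power)
  then show ?thesis by (simp add: minus_eq a_assoc r_neg)
qed

end

end

lemma (in ring_hom_ring) hom_add_pow:
  "x \<in> carrier R \<Longrightarrow> h ([(n::nat)] \<cdot>\<^bsub>R\<^esub> x) = [n] \<cdot>\<^bsub>S\<^esub> h x"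
  by (induction n) simp_all

text \<open>In characteristic \<open>p\<close> the \<open>q\<close>-th power map respects sums and
  differences as well as products, so its fixed points are closed under the field
  operations.\<close>

lemma (in field) frobenius_fixed_subfield:
  assumes p: "Factorial_Ring.prime (p::nat)" "[p] \<cdot> \<one> = \<zero>" "q = p ^ s"
  shows "subfield {x \<in> carrier R. x [^] q = x} R"
proof -
  note frob = add_pow_prime_power[OF p(1,2), of _ _ s, folded p(3)]
    minus_pow_prime_power[OF p(1,2), of _ _ s, folded p(3)]
  have q: "q > 0" using p prime_gt_0_nat by simp
  have inv: "(inv x) [^] q = inv x" if x: "x \<in> carrier R" "x [^] q = x" "x \<noteq> \<zero>" for x
  proof -
    have u: "x \<in> Units R" using x field_Units by auto
    \<comment> \<open>Reading the first factor as \<open>x [^] q\<close> shows that the power of the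
      inverse is again an inverse of \<open>x\<close>; inverses are unique.\<close>
    then have "x \<otimes> (inv x) [^] q = (x \<otimes> inv x) [^] q"
      using x by (simp add: nat_pow_distrib Units_inv_closed del: Units_r_inv)
    also have "\<dots> = \<one>" using u by simp
    finally show ?thesis using comm_inv_char[of x "(inv x) [^] q"] u x by (simp add: Units_inv_closed)
  qed
  show ?thesis
  proof (rule subfieldI', rule subringI)
    fix x assume x: "x \<in> {x \<in> carrier R. x [^] q = x}"
    have "(\<zero> \<ominus> x) [^] q = \<zero> \<ominus> x"
      using x frob(2)[of \<zero> x] q by (simp add: nat_pow_zero)
    then show "\<ominus> x \<in> {x \<in> carrier R. x [^] q = x}" using x by (simp add: minus_eq)
  qed (auto simp: frob nat_pow_distrib field_Units inv Units_inv_closed)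
qed

text \<open>Every root \<open>a\<close> is simple because
  \<open>X\<^sup>q - X = (X - a)\<^sup>q - (X - a)\<close> in characteristic \<open>p\<close>.\<close>

lemma (in algebraically_closed) card_frobenius_fixed:
  assumes p: "Factorial_Ring.prime (p::nat)" "[p] \<cdot> \<one> = \<zero>" "q = p ^ s" and s: "s > 0"
  shows "card {x \<in> carrier L. x [^] q = x} = q"
proof -
  let ?P = "poly_ring L" and ?X = "var L"
  interpret P: domain ?P by (rule univ_poly_is_domain[OF carrier_is_subring])
  have q: "q > 1" using one_less_power[OF prime_gt_1_nat[OF p(1)] s] p(3) by simp
  define f where "f = ?X [^]\<^bsub>?P\<^esub> q \<ominus>\<^bsub>?P\<^esub> ?X"
  have X: "?X \<in> carrier ?P" by (rule var_closed[OF carrier_is_subring])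
  have f: "f \<in> carrier ?P" using X by (simp add: f_def)
  have degX: "degree ?X = 1" by (simp add: var_def)
  have deg: "degree f = q"
  proof -
    have "degree (?X [^]\<^bsub>?P\<^esub> q) = q" using polynomial_pow_degree[OF X, of q] degX by simp
    moreover have "degree (\<ominus>\<^bsub>?P\<^esub> ?X) = 1"
      using univ_poly_a_inv_degree[OF carrier_is_subring X] degX by simp
    moreover have "polynomial (carrier L) (?X [^]\<^bsub>?P\<^esub> q)" "polynomial (carrier L) (\<ominus>\<^bsub>?P\<^esub> ?X)"
      using X by (simp_all add: univ_poly_carrier)
    ultimately show ?thesis
      using poly_add_degree_eq[OF carrier_is_subring, of "?X [^]\<^bsub>?P\<^esub> q" "\<ominus>\<^bsub>?P\<^esub> ?X"] q
      by (simp add: f_def P.minus_eq univ_poly_add)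
  qed
  have f0: "f \<noteq> []" using deg q by auto
  have eval_f: "eval f a = a [^] q \<ominus> a" if a: "a \<in> carrier L" for a
  proof -
    interpret e: ring_hom_ring ?P L "\<lambda>p. eval p a" by (rule eval_ring_hom[OF carrier_is_subring a])
    show ?thesis using X eval_var[OF a] by (simp add: f_def P.minus_eq minus_eq e.hom_nat_pow)
  qed
  have root: "a \<in># roots f \<longleftrightarrow> a \<in> carrier L \<and> a [^] q = a" for a
    using roots_mem_iff_is_root[OF f, of a] f0 eval_f by (auto simp: is_root_def)
  have simple: "count (roots f) a = 1" if a: "a \<in># roots f" for a
  proof -
    have aL: "a \<in> carrier L" and aq: "a [^] q = a" using a root by auto
    define c where "c = poly_of_const a"
    have hom: "poly_of_const \<in> ring_hom L ?P"
      using canonical_embedding_is_hom[OF carrier_is_subring] by simp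
    interpret h: ring_hom_ring L ?P poly_of_const
      by (rule ring_hom_ringI2[OF ring_axioms P.ring_axioms hom])
    have c: "c \<in> carrier ?P" "c [^]\<^bsub>?P\<^esub> q = c"
      using aL aq by (simp_all add: c_def flip: h.hom_nat_pow)
    have charP: "[p] \<cdot>\<^bsub>?P\<^esub> \<one>\<^bsub>?P\<^esub> = \<zero>\<^bsub>?P\<^esub>"
      using h.hom_add_pow[of \<one> p] p(2) by simp
    define Y where "Y = ?X \<ominus>\<^bsub>?P\<^esub> c"
    have Y: "Y \<in> carrier ?P" using X c by (simp add: Y_def)
    have Y_eq: "Y = [\<one>, \<ominus> a]"
    proof -
      have "Y = ?X \<oplus>\<^bsub>?P\<^esub> poly_of_const (\<ominus> a)" using aL by (simp add: Y_def c_def P.minus_eq)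
      then show ?thesis using aL by (simp add: univ_poly_add var_def poly_of_const_def)
    qed
    \<comment> \<open>The cofactor of the linear polynomial \<open>Y\<close> in \<open>f\<close>,
      since \<open>f\<close> will be rewritten as the \<open>q\<close>-th power of \<open>Y\<close>
      minus \<open>Y\<close>.\<close>
    define g where "g = Y [^]\<^bsub>?P\<^esub> (q - 1) \<ominus>\<^bsub>?P\<^esub> \<one>\<^bsub>?P\<^esub>"
    have g: "g \<in> carrier ?P" using Y by (simp add: g_def)
    have "Y [^]\<^bsub>?P\<^esub> q = ?X [^]\<^bsub>?P\<^esub> q \<ominus>\<^bsub>?P\<^esub> c"
      using P.minus_pow_prime_power[OF p(1) charP X c(1), of s] c(2) p(3) by (simp add: Y_def)
    then have "f = Y [^]\<^bsub>?P\<^esub> q \<ominus>\<^bsub>?P\<^esub> Y"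
      using X c by (simp add: f_def Y_def P.minus_eq P.minus_add P.a_ac P.r_neg1 P.r_neg2)
    also have "Y [^]\<^bsub>?P\<^esub> q = Y \<otimes>\<^bsub>?P\<^esub> Y [^]\<^bsub>?P\<^esub> (q - 1)"
      using P.nat_pow_Suc2[OF Y, of "q - 1"] q by simp
    also have "\<dots> \<ominus>\<^bsub>?P\<^esub> Y = Y \<otimes>\<^bsub>?P\<^esub> g"
      using Y by (simp add: g_def P.minus_eq P.r_distr P.r_minus)
    finally have fg: "f = [\<one>, \<ominus> a] \<otimes>\<^bsub>?P\<^esub> g" unfolding Y_eq .
    have "g \<noteq> []"
    proof
      assume "g = []"
      then have "f = \<zero>\<^bsub>?P\<^esub>" using fg Y Y_eq by (simp flip: univ_poly_zero[of L "carrier L"])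
      then show False using f0 by (simp add: univ_poly_zero)
    qed
    then have "roots f = add_mset a (roots g)"
      unfolding fg by (rule poly_mult_degree_one_monic_imp_same_roots[OF aL g])
    moreover have "a \<notin># roots g"
    proof
      \<comment> \<open>As \<open>Y\<close> vanishes at \<open>a\<close> and \<open>q > 1\<close>,
        the value of \<open>g\<close> at \<open>a\<close> is minus one.\<close>
      assume "a \<in># roots g"
      then have "eval g a = \<zero>" using roots_mem_iff_is_root[OF g] by (simp add: is_root_def)
      moreover interpret e: ring_hom_ring ?P L "\<lambda>p. eval p a"
        by (rule eval_ring_hom[OF carrier_is_subring aL])
      have "eval Y a = \<zero>" using aL by (simp add: Y_eq r_neg)
      then have "eval g a = \<zero> [^] (q - 1) \<ominus> \<one>"
        using Y by (simp add: g_def P.minus_eq minus_eq e.hom_nat_pow)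
      ultimately show False using q by (simp add: nat_pow_zero minus_eq)
    qed
    ultimately show ?thesis by (simp add: not_in_iff)
  qed
  \<comment> \<open>Over an algebraically closed field the roots with multiplicity number
    \<open>degree f\<close>, which is \<open>q\<close>; multiplicity one makes this the number of
    distinct roots.\<close>
  have "size (roots f) = (\<Sum>a\<in>set_mset (roots f). count (roots f) a)"
    by (rule size_multiset_overloaded_eq)
  also have "\<dots> = card (set_mset (roots f))" using simple by simp
  finally have "card (set_mset (roots f)) = q"
    using roots_over_carrier[OF f] deg by (simp add: splitted_def)
  moreover have "set_mset (roots f) = {x \<in> carrier L. x [^] q = x}" using root by auto
  ultimately show ?thesis by simp
qed

text \<open>The Galois field is cut out of an algebraic closure of the integers modulo
  \<open>p\<close> as the set of fixed points of the \<open>p ^ s\<close>-power map, and then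
  carried to natural numbers along an injection, giving a carrier type independent of
  \<open>p\<close> and \<open>s\<close>.\<close>

lemma nat_field_exists:
  assumes p: "Factorial_Ring.prime (p::nat)" and s: "s > 0"
  shows "\<exists>K :: nat ring. field K \<and> card (carrier K) = p ^ s"
proof -
  define R where "R = residue_ring (int p)"
  interpret R: residues_prime p R by unfold_locales (use p R_def in auto)
  define L where "L = R.alg_closure"
  interpret L: algebraic_closure L "R.indexed_const ` carrier R"
    unfolding L_def by (rule R.alg_closureE)
  interpret h: ring_hom_ring R L R.indexed_const
    using R.alg_closureE(2) by (intro ring_hom_ringI2) (auto simp: L_def R.ring_axioms L.ring_axioms[unfolded L_def])
  \<comment> \<open>Computes the characteristic in the residue ring; the embedding of constants then
    transfers it to the closure.\<close>
  have "[n] \<cdot>\<^bsub>R\<^esub> \<one>\<^bsub>R\<^esub> = int n mod int p" for n :: nat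
    by (induction n) (auto simp: R.res_zero_eq R.res_one_eq R.res_add_eq mod_simps add.commute)
  then have "[p] \<cdot>\<^bsub>R\<^esub> \<one>\<^bsub>R\<^esub> = \<zero>\<^bsub>R\<^esub>" by (simp add: R.res_zero_eq)
  then have char: "[p] \<cdot>\<^bsub>L\<^esub> \<one>\<^bsub>L\<^esub> = \<zero>\<^bsub>L\<^esub>"
    using h.hom_add_pow[of "\<one>\<^bsub>R\<^esub>" p] by simp
  define S where "S = {x \<in> carrier L. x [^]\<^bsub>L\<^esub> (p ^ s) = x}"
  have S: "subfield S L" unfolding S_def by (rule L.frobenius_fixed_subfield[OF p char refl])
  have card: "card S = p ^ s" unfolding S_def by (rule L.card_frobenius_fixed[OF p char refl s])
  interpret F: field "L\<lparr>carrier := S\<rparr>" by (rule L.subfield_iff(2)[OF S])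
  have "finite S" using card p by (metis card.infinite power_not_zero not_prime_0)
  then obtain b :: "_ \<Rightarrow> nat" where b: "inj_on b S" by (metis finite_imp_inj_to_nat_seg)
  have "field (image_ring b (L\<lparr>carrier := S\<rparr>))" using b by (intro F.inj_imp_image_ring_is_field) simp
  moreover have "card (carrier (image_ring b (L\<lparr>carrier := S\<rparr>))) = p ^ s"
    using b card by (simp add: image_ring_carrier card_image)
  ultimately show ?thesis by blast
qed

section \<open>Rings whose elements sum to zero\<close>

text \<open>A third element \<open>a\<close> exists besides zero and one. Multiplication by
  \<open>a\<close> permutes the field, so the sum \<open>S\<close> satisfies \<open>a S = S\<close>,
  which forces \<open>S\<close> to vanish.\<close>

lemma (in field) finsum_carrier_zero:
  assumes "finite (carrier R)" "3 \<le> card (carrier R)"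
  shows "(\<Oplus>x\<in>carrier R. x) = \<zero>"
proof -
  let ?S = "\<Oplus>x\<in>carrier R. x"
  have "card {\<zero>, \<one>} < card (carrier R)" using assms by (simp add: card_insert_if)
  then have "\<not> carrier R \<subseteq> {\<zero>, \<one>}" by (meson card_mono finite.emptyI finite.insertI linorder_not_less)
  then obtain a where a: "a \<in> carrier R" "a \<noteq> \<zero>" "a \<noteq> \<one>" by blast
  have inj: "inj_on ((\<otimes>) a) (carrier R)" using a m_lcancel by (auto intro: inj_onI)
  then have surj: "(\<otimes>) a ` carrier R = carrier R"
    using a assms(1) by (intro endo_inj_surj) auto
  have S: "?S \<in> carrier R" by (rule finsum_closed) simp
  have "a \<otimes> ?S = (\<Oplus>x\<in>carrier R. a \<otimes> x)"
    using a assms(1) by (intro finsum_rdistr) auto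
  also have "\<dots> = (\<Oplus>x\<in>(\<otimes>) a ` carrier R. x)"
    using a inj by (intro finsum_reindex[symmetric]) auto
  finally have "a \<otimes> ?S = \<one> \<otimes> ?S" using surj S by simp
  then have "(a \<ominus> \<one>) \<otimes> ?S = \<zero>" using a S by (simp add: minus_eq l_distr l_minus r_neg)
  then show ?thesis using a S integral_iff[of "a \<ominus> \<one>" ?S] by simp
qed

text \<open>Negation permutes the group, so the sum of all elements equals its own negative.\<close>

lemma (in abelian_group) double_finsum_carrier:
  assumes "finite (carrier G)"
  shows "[(2::nat)] \<cdot> (\<Oplus>x\<in>carrier G. x) = \<zero>"
proof -
  have S: "(\<Oplus>x\<in>carrier G. x) \<in> carrier G" by (rule finsum_closed) simp
  have inj: "inj_on (\<lambda>x. \<ominus> x) (carrier G)" by (metis inj_onI minus_minus)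
  have surj: "(\<lambda>x. \<ominus> x) ` carrier G = carrier G"
    using inj assms by (intro endo_inj_surj) auto
  have "(\<Oplus>x\<in>carrier G. x) = (\<Oplus>x\<in>(\<lambda>x. \<ominus> x) ` carrier G. x)" using surj by simp
  also have "\<dots> = (\<Oplus>x\<in>carrier G. \<ominus> x)" using inj by (intro finsum_reindex) auto
  finally have "(\<Oplus>x\<in>carrier G. x) \<oplus> (\<Oplus>x\<in>carrier G. x) = (\<Oplus>x\<in>carrier G. x \<oplus> \<ominus> x)"
    by (simp add: finsum_addf)
  also have "\<dots> = (\<Oplus>x\<in>carrier G. \<zero>)" by (intro finsum_cong') (auto simp: r_neg)
  finally show ?thesis using S by (simp add: numeral_2_eq_2)
qed

lemma (in abelian_group) finsum_even_finsum_carrier: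
  assumes "finite (carrier G)" "even (card I)"
  shows "(\<Oplus>i\<in>I. \<Oplus>x\<in>carrier G. x) = \<zero>"
proof -
  have S: "(\<Oplus>x\<in>carrier G. x) \<in> carrier G" by (rule finsum_closed) simp
  obtain j where "card I = 2 * j" using assms by blast
  then show ?thesis
    using S double_finsum_carrier[OF assms(1)] add.finprod_const[OF S, of I]
      add.nat_pow_pow[OF S, of j 2] by simp
qed

text \<open>The sum is annihilated by 2 and by the odd order of the ring, hence by 1.\<close>

lemma (in ring) odd_finsum_carrier:
  assumes "finite (carrier R)" "odd (card (carrier R))"
  shows "(\<Oplus>x\<in>carrier R. x) = \<zero>"
proof -
  have S: "(\<Oplus>x\<in>carrier R. x) \<in> carrier R" (is "?S \<in> _") by (rule finsum_closed) simp
  obtain j where j: "card (carrier R) = Suc (2 * j)" using assms by (auto elim: oddE)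
  have "[(Suc (2 * j))] \<cdot> ?S = \<zero>"
    using finsum_const_card[OF assms(1) S refl] add.finprod_const[OF S, of "carrier R"] j by simp
  moreover have "[(2 * j)] \<cdot> ?S = \<zero>"
    using double_finsum_carrier[OF assms(1)] add.nat_pow_pow[OF S, of j 2] by simp
  ultimately show ?thesis using S by simp
qed

section \<open>Direct products of rings\<close>

lemma RDirProd_simps:
  "x \<oplus>\<^bsub>RDirProd R S\<^esub> y = (fst x \<oplus>\<^bsub>R\<^esub> fst y, snd x \<oplus>\<^bsub>S\<^esub> snd y)"
  "x \<otimes>\<^bsub>RDirProd R S\<^esub> y = (fst x \<otimes>\<^bsub>R\<^esub> fst y, snd x \<otimes>\<^bsub>S\<^esub> snd y)"
  "\<zero>\<^bsub>RDirProd R S\<^esub> = (\<zero>\<^bsub>R\<^esub>, \<zero>\<^bsub>S\<^esub>)"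
  by (auto simp: RDirProd_def DirProd_def monoid.defs split: prod.splits)

lemma RDirProd_cring:
  assumes "cring R" "cring S" shows "cring (RDirProd R S)"
proof -
  interpret R: cring R by fact
  interpret S: cring S by fact
  interpret D: ring "RDirProd R S" by (rule RDirProd_ring) unfold_locales
  show ?thesis
    by unfold_locales (auto simp: RDirProd_simps RDirProd_carrier R.m_comm S.m_comm)
qed

lemma finsum_RDirProd:
  assumes "ring R" "ring S" and "f \<in> I \<rightarrow> carrier R \<times> carrier S"
  shows "finsum (RDirProd R S) f I = (finsum R (\<lambda>i. fst (f i)) I, finsum S (\<lambda>i. snd (f i)) I)"
proof -
  interpret R: ring R by fact
  interpret S: ring S by fact
  interpret D: ring "RDirProd R S" by (rule RDirProd_ring) unfold_locales
  show ?thesis using assms(3)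
  proof (induction I rule: infinite_finite_induct)
    case (insert i I)
    then have "f \<in> I \<rightarrow> carrier (RDirProd R S)" "f i \<in> carrier (RDirProd R S)"
      "(\<lambda>i. fst (f i)) \<in> I \<rightarrow> carrier R" "(\<lambda>i. snd (f i)) \<in> I \<rightarrow> carrier S"
      "fst (f i) \<in> carrier R" "snd (f i) \<in> carrier S"
      by (auto simp: RDirProd_carrier Pi_iff mem_Times_iff)
    with insert show ?case by (simp add: RDirProd_simps)
  qed (simp_all add: RDirProd_simps)
qed

text \<open>Each coordinate of the sum is the sum over one factor repeated as often as the other
  factor has elements. That number is even, and twice the sum over a factor is zero.\<close>

lemma RDirProd_finsum_carrier:
  assumes "ring R" "ring S" and fin: "finite (carrier R)" "finite (carrier S)"
    and even: "even (card (carrier R))" "even (card (carrier S))"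
  shows "(\<Oplus>\<^bsub>RDirProd R S\<^esub>x\<in>carrier (RDirProd R S). x) = \<zero>\<^bsub>RDirProd R S\<^esub>"
proof -
  interpret R: ring R by fact
  interpret S: ring S by fact
  have "(\<Oplus>\<^bsub>R\<^esub>x\<in>carrier R \<times> carrier S. fst x) = (\<Oplus>\<^bsub>R\<^esub>a\<in>carrier R. \<Oplus>\<^bsub>R\<^esub>b\<in>carrier S. a)"
    using R.finsum_cartesian[OF fin, of "\<lambda>a b. a"] by simp
  also have "\<dots> = \<zero>\<^bsub>R\<^esub>"
    using R.finsum_swap[OF fin, of "\<lambda>a b. a"] R.finsum_even_finsum_carrier[OF fin(1) even(2)] by simp
  finally have R0: "(\<Oplus>\<^bsub>R\<^esub>x\<in>carrier R \<times> carrier S. fst x) = \<zero>\<^bsub>R\<^esub>" .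
  have S0: "(\<Oplus>\<^bsub>S\<^esub>x\<in>carrier R \<times> carrier S. snd x) = \<zero>\<^bsub>S\<^esub>"
    using S.finsum_cartesian[OF fin, of "\<lambda>a b. b"] S.finsum_even_finsum_carrier[OF fin(2) even(1)] by simp
  show ?thesis
    using R0 S0 by (subst finsum_RDirProd[OF assms(1,2)]) (auto simp: RDirProd_carrier RDirProd_simps)
qed

section \<open>Transport of rings to the natural numbers\<close>

lemma (in cring) inj_imp_image_ring_is_cring:
  assumes "inj_on f (carrier R)" shows "cring (image_ring f R)"
  using ring_iso_imp_img_cring[OF inj_imp_image_ring_iso[OF assms]]
  by (simp add: image_ring_def image_group_def monoid.defs)

lemma (in cring) finsum_image_ring:
  assumes inj: "inj_on f (carrier R)" and zero: "(\<Oplus>x\<in>carrier R. x) = \<zero>"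
  shows "(\<Oplus>\<^bsub>image_ring f R\<^esub>x\<in>carrier (image_ring f R). x) = \<zero>\<^bsub>image_ring f R\<^esub>"
proof -
  interpret I: cring "image_ring f R" by (rule inj_imp_image_ring_is_cring[OF inj])
  interpret h: ring_hom_cring R "image_ring f R" f
    using inj_imp_image_ring_iso[OF inj] by unfold_locales (simp add: ring_iso_def)
  have "(\<Oplus>\<^bsub>image_ring f R\<^esub>x\<in>f ` carrier R. x) = (\<Oplus>\<^bsub>image_ring f R\<^esub>x\<in>carrier R. f x)"
    using inj by (intro I.finsum_reindex) auto
  also have "\<dots> = f (\<Oplus>x\<in>carrier R. x)" by (subst h.hom_finsum) (auto simp: comp_def)
  finally show ?thesis using zero by (simp add: image_ring_carrier)
qed

lemma nat_cring_exists:
  assumes k: "3 \<le> k" "k mod 4 \<noteq> 2"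
  shows "\<exists>K :: nat ring. cring K \<and> card (carrier K) = k \<and> (\<Oplus>\<^bsub>K\<^esub>x\<in>carrier K. x) = \<zero>\<^bsub>K\<^esub>"
proof -
  \<comment> \<open>Allows the ring to be built on any type: being finite, its carrier injects into
    the natural numbers, and the sum of its elements is carried along.\<close>
  have transport: ?thesis
    if "cring R" "card (carrier R) = k" "(\<Oplus>\<^bsub>R\<^esub>x\<in>carrier R. x) = \<zero>\<^bsub>R\<^esub>" for R :: "'a ring"
  proof -
    interpret cring R by fact
    have "finite (carrier R)" using that k card.infinite by fastforce
    then obtain b :: "'a \<Rightarrow> nat" where b: "inj_on b (carrier R)" by (metis finite_imp_inj_to_nat_seg)
    then show ?thesis
      using inj_imp_image_ring_is_cring[OF b] finsum_image_ring[OF b that(3)] that(2)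
      by (intro exI[of _ "image_ring b R"]) (simp add: image_ring_carrier card_image)
  qed
  have res: "cring (residue_ring (int m)) \<and> finite (carrier (residue_ring (int m)))
    \<and> card (carrier (residue_ring (int m))) = m" if "m > 1" for m :: nat
  proof -
    interpret residues "int m" "residue_ring (int m)" by unfold_locales (use that in auto)
    show ?thesis using that cring_axioms by (simp add: res_carrier_eq)
  qed
  show ?thesis
  proof (cases "odd k")
    case True
    have "cring (residue_ring (int k))" using res[of k] k by simp
    then show ?thesis
      using ring.odd_finsum_carrier[of "residue_ring (int k)"] res[of k] True k
      by (intro transport[of "residue_ring (int k)"]) (auto intro: cring.axioms)
  next
    case False
    then obtain m where "k = 2 * m" by blast
    \<comment> \<open>The congruence condition says exactly that the cofactor \<open>m\<close> of 2
      is even, so both factors of the product have even order.\<close>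
    then have m: "k = 2 * m" "even m" "m > 1" using k by presburger+
    let ?A = "residue_ring (int 2)" and ?B = "residue_ring (int m)"
    have A: "cring ?A" "finite (carrier ?A)" "card (carrier ?A) = 2" using res[of 2] by auto
    have B: "cring ?B" "finite (carrier ?B)" "card (carrier ?B) = m" using res[of m] m by auto
    show ?thesis
    proof (rule transport)
      show "cring (RDirProd ?A ?B)" by (rule RDirProd_cring[OF A(1) B(1)])
      show "card (carrier (RDirProd ?A ?B)) = k" using A B m by (simp add: RDirProd_carrier card_cartesian_product)
      show "(\<Oplus>\<^bsub>RDirProd ?A ?B\<^esub>x\<in>carrier (RDirProd ?A ?B). x) = \<zero>\<^bsub>RDirProd ?A ?B\<^esub>"
        using A B m by (intro RDirProd_finsum_carrier) (auto intro: cring.axioms)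
    qed
  qed
qed

section \<open>The classification\<close>

theorem theorem1p3:
  fixes E :: "'a set" and indep :: "'a set \<Rightarrow> bool" and k :: nat
  assumes "simple_matroid E indep" and "3 \<le> k"
  shows "(\<forall>K :: 'b set. card K = k \<longrightarrow>
            bij_betw (matroid.net_function E K) (matroid.nets E indep K)
              (matroid.special_functions E indep K - matroid.const_functions E K))
       \<and> (k mod 4 \<noteq> 2 \<longrightarrow>
            (\<exists>K :: nat ring. cring K \<and> card (carrier K) = k \<and>
               matroid.special_functions E indep (carrier K) \<subseteq> matroid.cocycles E indep K) \<and>
            (\<forall>(p::nat) s. Factorial_Ring.prime p \<and> k = p ^ s \<longrightarrow>
               (\<exists>K :: nat ring. field K \<and> card (carrier K) = k \<and>
                  matroid.special_functions E indep (carrier K) \<subseteq> matroid.cocycles E indep K)))"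
proof -
  interpret simple_matroid E indep by (rule assms(1))
  have i: "\<forall>K :: 'b set. card K = k \<longrightarrow>
    bij_betw (net_function K) (nets K) (special_functions K - const_functions K)"
    using net_function_bij_betw assms(2) by blast
  have finite: "finite (carrier K)" if "card (carrier K) = k" for K :: "nat ring"
    using that assms(2) card.infinite by fastforce
  have ring: "\<exists>K :: nat ring. cring K \<and> card (carrier K) = k \<and> special_functions (carrier K) \<subseteq> cocycles K"
    if k: "k mod 4 \<noteq> 2"
  proof -
    obtain K :: "nat ring" where K: "cring K" "card (carrier K) = k"
      "(\<Oplus>\<^bsub>K\<^esub>x\<in>carrier K. x) = \<zero>\<^bsub>K\<^esub>"
      using nat_cring_exists[OF assms(2) k] by blast
    then show ?thesis
      using special_functions_subset_cocycles[OF cring.axioms(1)[OF K(1)] finite[OF K(2)] K(3)] by blast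
  qed
  have field: "\<exists>K :: nat ring. field K \<and> card (carrier K) = k \<and> special_functions (carrier K) \<subseteq> cocycles K"
    if p: "Factorial_Ring.prime p" and k: "k = p ^ s" for p s :: nat
  proof -
    \<comment> \<open>An exponent 0 would give \<open>k = 1\<close>, against
      \<open>3 \<le> k\<close>.\<close>
    have "s > 0" using k assms(2) by (cases s) auto
    then obtain K :: "nat ring" where K: "field K" "card (carrier K) = k"
      using nat_field_exists[OF p] k by blast
    interpret K: field K by (rule K(1))
    show ?thesis
      using special_functions_subset_cocycles[OF K.ring_axioms finite[OF K(2)]
          K.finsum_carrier_zero[OF finite[OF K(2)]]] K assms(2) by auto
  qed
  from i ring field show ?thesis by blast
qed

end
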